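(* Every regular topological space $X$ whose density $d(X)$ is infinite has a Shapirovskii $\pi$-base.
   Context: Regular spaces are assumed $T_1$. $\mathcal T_X$ is the family of all nonempty open subsets of $X$. A family $\mathcal R\subseteq\mathcal T_X$ is a local $\pi$-base for $p\in X$ if every open $U\ni p$ contains some $R\in\mathcal R$; $\pi\chi(p,X)$ is the least cardinality of a local $\pi$-base for $p$, and $\pi\chi(X)=\sup\{\pi\chi(p,X):p\in X\}$. $d(X)$ is the least cardinality of a dense subset. For $P=\{p_\alpha:\alpha<\mu\}$ and $\delta\le\mu$ write $P_\delta=\{p_\alpha:\alpha<\delta\}$ and $P^\delta=\{p_\alpha:\delta\le\alpha<\mu\}$. $P$ is left-separated (as written) if $\overline{P_\delta}\cap P^\delta=\emptyset$ for every $\delta<\mu$. The function $\gamma_\kappa$. For an infinite cardinal $\kappa$ let $\sigma=\sigma_\kappa$ be the class function on ordinals with $\sigma(0)=0$, $\sigma(1)=\kappa$, $\sigma(\alpha+1)=\sigma(\alpha)+|\sigma(\alpha)|$ for $\alpha>0$, and $\sigma(\beta)=\sup_{\alpha<\beta}\sigma(\alpha)$ for limit $\beta$ (ordinal sums). Every ordinal $\delta$ is uniquely of the form $\delta=\sigma(\alpha_0)+\dots+\sigma(\alpha_{n-1})+\Delta$ with $n\in\omega$, $|\sigma(\alpha_0)|>\dots>|\sigma(\alpha_{n-1})|$, $\alpha_{n-1}>0$, $\Delta<\kappa$. Put $\gamma_\kappa(\delta)=0$ if $n=0$ and $\gamma_\kappa(\delta)=\sigma(\alpha_0)+\dots+\sigma(\alpha_{n-2})$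 otherwise (so it is $0$ if $n=1$). Shapirovskii $\pi$-base. Let $X$ be regular, $\lambda=d(X)$ infinite, and $\kappa=\max\{\omega,\pi\chi(X)\}$. A Shapirovskii $\pi$-base for $X$ is an indexed family $\mathcal S=\{S_{\alpha,i}:\langle\alpha,i\rangle\in\lambda\times\kappa\}\subseteq\mathcal T_X$ together with a dense subspace $P=\{p_\alpha:\alpha<\lambda\}$ of $X$, left-separated as written, such that: (a) for each $\alpha<\lambda$, $\{S_{\alpha,i}:i<\kappa\}$ is a local $\pi$-base for $p_\alpha$ in $X$; (b) for each $\alpha<\lambda$, $\overline{P_\alpha}\cap\bigcup\{\overline{S_{\beta,i}}:\alpha\le\beta<\lambda,\ i<\kappa\}=\emptyset$; (c) for every ordinal $\delta$ with $0<\delta\le\lambda$ of the form $\delta=\kappa\cdot\epsilon$ (ordinal product) and every finite $A\subseteq[\gamma_\kappa(\delta),\delta)\times\kappa$, if $\bigcap_{a\in A}\overline{S_a}\ne\emptyset$ then $\bigcap_{a\in A}\overline{S_a}\cap\bigcup\{\overline{P_\alpha}:\alpha<\delta\}\neq\emptyset$ (hence $\bigcap_{a\in A}\overline{S_a}\cap\overline{P_\delta}\ne\emptyset$). Here the intersection of the empty family is $X$. *)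

theory Defs
  imports "HOL-Analysis.Analysis"
begin

unbundle cardinal_syntax

section \<open>Ordinals\<close>

text \<open>
  HOL has no type of all ordinals. The type \<open>'b ordinal\<close> consists of the ordinals below
  the successor cardinal of \<open>max |'b| \<omega>\<close>. This is an uncountable regular cardinal, so
  every subset of cardinality at most \<open>max |'b| \<omega>\<close> is bounded (lemma \<open>ordinal_bounded\<close>)
  and the type is closed under the ordinal operations used below. The summand \<open>nat\<close> only
  serves to make the bound infinite.
\<close>

typedef 'b ordinal = "Field (cardSuc |UNIV :: ('b + nat) set| )"
proof -
  have "infinite (Field (cardSuc |UNIV :: ('b + nat) set| ))"
    by (simp add: card_of_cardSuc_finite)
  then show ?thesis by (metis ex_in_conv finite.emptyI)
qed

lemma Card_order_ordinal: "Card_order (cardSuc |UNIV :: ('b + nat) set| )"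
  by (simp add: cardSuc_Card_order card_of_Card_order)

instantiation ordinal :: (type) wellorder
begin

definition "\<alpha> \<le> \<beta> \<longleftrightarrow> (Rep_ordinal \<alpha>, Rep_ordinal \<beta>) \<in> cardSuc |UNIV :: ('a + nat) set|"
  for \<alpha> \<beta> :: "'a ordinal"

definition "\<alpha> < \<beta> \<longleftrightarrow> \<alpha> \<le> \<beta> \<and> \<not> \<beta> \<le> \<alpha>"
  for \<alpha> \<beta> :: "'a ordinal"

instance
proof
  let ?r = "cardSuc |UNIV :: ('a + nat) set|"
  have wo: "well_order_on (Field ?r) ?r"
    using Card_order_ordinal unfolding card_order_on_def by blast
  then have R: "refl_on (Field ?r) ?r" "trans ?r" "antisym ?r" "total_on (Field ?r) ?r"
    and wf: "wf (?r - Id)"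
    unfolding well_order_on_def linear_order_on_def partial_order_on_def preorder_on_def by auto
  fix x y z :: "'a ordinal"
  show "x < y \<longleftrightarrow> x \<le> y \<and> \<not> y \<le> x" by (rule less_ordinal_def)
  show "x \<le> x"
    using R(1) Rep_ordinal unfolding less_eq_ordinal_def refl_on_def by blast
  show "x \<le> z" if "x \<le> y" "y \<le> z"
    using R(2) that unfolding less_eq_ordinal_def by (meson transD)
  show eq: "x = y" if "x \<le> y" "y \<le> x" for x y :: "'a ordinal"
    using R(3) that unfolding less_eq_ordinal_def by (metis Rep_ordinal_inject antisymD)
  show "x \<le> y \<or> y \<le> x"
    using R(1,4) Rep_ordinal[of x] Rep_ordinal[of y]
    unfolding less_eq_ordinal_def refl_on_def total_on_def by metis
  fix P :: "'a ordinal \<Rightarrow> bool" and a :: "'a ordinal"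
  assume step: "\<And>x. (\<And>y. y < x \<Longrightarrow> P y) \<Longrightarrow> P x"
  have "{(x, y). x < y} \<subseteq> inv_image (?r - Id) (Rep_ordinal :: 'a ordinal \<Rightarrow> _)"
    by (auto simp: less_ordinal_def less_eq_ordinal_def Rep_ordinal_inject)
  then have "wf {(x, y :: 'a ordinal). x < y}"
    using wf_inv_image[OF wf] wf_subset by blast
  then show "P a"
    by (induction a rule: wf_induct_rule) (auto intro: step)
qed

end

lemma lepoll_iff_card_of_ordLeq: "A \<lesssim> B \<longleftrightarrow> |A| \<le>o |B|"
  by (simp add: card_of_ordLeq lepoll_def)

lemma atMost_ordinal_lepoll: "{..\<alpha> :: 'b ordinal} \<lesssim> (UNIV :: ('b + nat) set)"
proof -
  let ?U = "UNIV :: ('b + nat) set"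
  let ?r = "cardSuc |?U|"
  have inf: "infinite ?U" by simp
  let ?a = "Rep_ordinal \<alpha>"
  have "|underS ?r ?a| <o ?r"
    using Card_order_ordinal Rep_ordinal by (rule card_of_underS)
  then have "|underS ?r ?a| \<le>o |?U|"
    by (simp add: card_of_Card_order cardSuc_ordLeq_ordLess)
  moreover have "Rep_ordinal ` {..\<alpha>} \<subseteq> insert ?a (underS ?r ?a)"
    by (auto simp: underS_def less_eq_ordinal_def)
  moreover have "insert ?a (underS ?r ?a) \<lesssim> ?U" if "underS ?r ?a \<lesssim> ?U"
  proof (cases "finite (underS ?r ?a)")
    case True
    then show ?thesis using inf by (simp add: finite_lepoll_infinite)
  next
    case False
    then show ?thesis using that
      by (meson infinite_insert_eqpoll eqpoll_imp_lepoll lepoll_trans)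
  qed
  ultimately have "Rep_ordinal ` {..\<alpha>} \<lesssim> ?U"
    by (meson lepoll_iff_card_of_ordLeq lepoll_trans subset_imp_lepoll)
  moreover have "Rep_ordinal ` {..\<alpha>} \<approx> {..\<alpha>}"
    by (rule inj_on_image_eqpoll_self) (simp add: Rep_ordinal_inject inj_on_def)
  ultimately show ?thesis by (meson eqpoll_imp_lepoll eqpoll_sym lepoll_trans)
qed

lemma ordinal_bounded:
  fixes A :: "'b ordinal set"
  assumes "A \<lesssim> (UNIV :: ('b + nat) set)"
  shows "\<exists>\<beta>. \<forall>\<alpha>\<in>A. \<alpha> < \<beta>"
proof (rule ccontr)
  let ?U = "UNIV :: ('b + nat) set"
  let ?r = "cardSuc |?U|"
  assume "\<not> ?thesis"
  then have cover: "\<exists>\<alpha>\<in>A. \<beta> \<le> \<alpha>" for \<beta> by (meson not_less)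
  have inf: "infinite ?U" by simp
  have "(UNIV :: 'b ordinal set) = (\<Union>\<alpha>\<in>A. {..\<alpha>})"
    using cover by auto
  moreover have "|\<Union>\<alpha>\<in>A. {..\<alpha>}| \<le>o |?U|"
    by (rule card_of_UNION_ordLeq_infinite[OF inf])
      (use assms atMost_ordinal_lepoll in \<open>auto simp: lepoll_iff_card_of_ordLeq\<close>)
  ultimately have "|UNIV :: 'b ordinal set| \<le>o |?U|" by simp
  moreover have "bij_betw Rep_ordinal (UNIV :: 'b ordinal set) (Field ?r)"
    by (simp add: bij_betw_def inj_def Rep_ordinal_inject type_definition.Rep_range[OF type_definition_ordinal])
  then have "|UNIV :: 'b ordinal set| =o |Field ?r|" by (simp add: card_of_ordIsoI)
  then have "|UNIV :: 'b ordinal set| =o ?r"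
    using card_of_Field_ordIso[OF Card_order_ordinal] ordIso_transitive by blast
  ultimately have "?r \<le>o |?U|" by (meson ordIso_iff_ordLeq ordLeq_transitive)
  then show False
    using cardSuc_greater[OF card_of_Card_order, of ?U] not_ordLess_ordLeq by blast
qed

function ordinal_add :: "'b ordinal \<Rightarrow> 'b ordinal \<Rightarrow> 'b ordinal" where
  "ordinal_add \<alpha> \<beta> = (LEAST \<zeta>. \<alpha> \<le> \<zeta> \<and> (\<forall>\<gamma>\<in>{..<\<beta>}. ordinal_add \<alpha> \<gamma> < \<zeta>))"
  by auto
termination
  by (relation "inv_image {(x, y). x < y} snd") (auto intro: wf)

instantiation ordinal :: (type) "{zero, one, plus}"
begin

definition "0 = (LEAST \<zeta> :: 'a ordinal. True)"
definition "1 = (LEAST \<zeta> :: 'a ordinal. 0 < \<zeta>)"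
definition "\<alpha> + \<beta> = ordinal_add \<alpha> \<beta>" for \<alpha> \<beta> :: "'a ordinal"

instance ..

end

text \<open>Ordinal product: \<open>\<alpha> * \<beta>\<close> is \<open>\<beta>\<close> copies of \<open>\<alpha>\<close>, i.e. \<open>\<alpha> * (\<beta> + 1) = \<alpha> * \<beta> + \<alpha>\<close>.\<close>

function ordinal_mult :: "'b ordinal \<Rightarrow> 'b ordinal \<Rightarrow> 'b ordinal" where
  "ordinal_mult \<alpha> \<beta> = (LEAST \<zeta>. \<forall>\<gamma>\<in>{..<\<beta>}. ordinal_mult \<alpha> \<gamma> + \<alpha> \<le> \<zeta>)"
  by auto
termination
  by (relation "inv_image {(x, y). x < y} snd") (auto intro: wf)

instantiation ordinal :: (type) times
begin

definition "\<alpha> * \<beta> = ordinal_mult \<alpha> \<beta>" for \<alpha> \<beta> :: "'a ordinal"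

instance ..

end

declare ordinal_add.simps [simp del] ordinal_mult.simps [simp del]

definition ord_sup :: "'b ordinal set \<Rightarrow> 'b ordinal" where
  "ord_sup A = (LEAST \<zeta>. \<forall>\<alpha>\<in>A. \<alpha> \<le> \<zeta>)"

text \<open>
  Cardinals are initial ordinals; an ordinal is identified with the set of its predecessors.
  \<open>ord_card A\<close> is meaningful only if \<open>A\<close> has cardinality at most \<open>max |'b| \<omega>\<close>.
\<close>

definition ord_card :: "'x set \<Rightarrow> 'b ordinal" where
  "ord_card A = (LEAST \<alpha>. {..<\<alpha>} \<approx> A)"

abbreviation card_of_ord :: "'b ordinal \<Rightarrow> 'b ordinal" where
  "card_of_ord \<alpha> \<equiv> ord_card {..<\<alpha>}"

definition ord_omega :: "'b ordinal" where
  "ord_omega = ord_card (UNIV :: nat set)"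

lemma ord_card_eqpoll:
  assumes "A \<lesssim> (UNIV :: ('b + nat) set)"
  shows "{..<ord_card A :: 'b ordinal} \<approx> A"
proof -
  let ?r = "cardSuc |UNIV :: ('b + nat) set|"
  have wo: "Well_order ?r"
    using Card_order_ordinal unfolding card_order_on_def by blast
  have "|A| <o ?r"
    using assms by (simp add: cardSuc_ordLeq_ordLess card_of_Card_order lepoll_iff_card_of_ordLeq)
  then obtain a where a: "a \<in> Field ?r" "|A| =o Restr ?r (underS ?r a)"
    using ordLess_iff_ordIso_Restr[OF wo card_of_Well_order] by blast
  have "underS ?r a \<subseteq> Field ?r" by (auto simp: underS_def Field_def)
  then have "Field (Restr ?r (underS ?r a)) = underS ?r a"
    using wo by (simp add: Refl_Field_Restr2 order_on_defs)
  then have "|A| =o |underS ?r a|"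
    using card_of_cong[OF a(2)] by (simp add: Field_card_of)
  moreover have "Rep_ordinal ` {..<Abs_ordinal a} = underS ?r a"
  proof -
    have "x \<in> Rep_ordinal ` {..<Abs_ordinal a}" if "x \<in> underS ?r a" for x
    proof (rule image_eqI)
      have x: "x \<in> Field ?r" "x \<noteq> a" "(x, a) \<in> ?r"
        using that by (auto simp: underS_def Field_def)
      then show "x = Rep_ordinal (Abs_ordinal x)" by (simp add: Abs_ordinal_inverse)
      show "Abs_ordinal x \<in> {..<Abs_ordinal a}"
        using x a(1) by (simp add: less_le less_eq_ordinal_def Abs_ordinal_inverse Abs_ordinal_inject)
    qed
    moreover have "Rep_ordinal y \<in> underS ?r a" if "y < Abs_ordinal a" for y
      using that a(1)
      by (auto simp: underS_def less_le less_eq_ordinal_def Abs_ordinal_inverse Rep_ordinal_inverse)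
    ultimately show ?thesis by auto
  qed
  then have "underS ?r a \<approx> {..<Abs_ordinal a}"
    by (metis Rep_ordinal_inject inj_on_def inj_on_image_eqpoll_self)
  ultimately have "{..<Abs_ordinal a} \<approx> A"
    by (meson eqpoll_iff_card_of_ordIso eqpoll_sym eqpoll_trans)
  then show ?thesis unfolding ord_card_def by (rule LeastI)
qed

lemma ordinal_0_le [simp]: "0 \<le> (\<alpha> :: 'b ordinal)"
  unfolding zero_ordinal_def by (rule Least_le) simp

lemma not_less_ordinal_0 [simp]: "\<not> (\<alpha> :: 'b ordinal) < 0"
  by (simp add: leD)

lemma lessThan_ordinal_0 [simp]: "{..<0 :: 'b ordinal} = {}"
  by auto

lemma ordinal_ex_greater: "\<exists>\<beta>. (\<alpha> :: 'b ordinal) < \<beta>"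
  using ordinal_bounded[of "{\<alpha>}"] by (auto simp: finite_lepoll_infinite)

lemma ordinal_add_0 [simp]: "\<alpha> + 0 = (\<alpha> :: 'b ordinal)"
  by (simp add: plus_ordinal_def ordinal_add.simps[of \<alpha> 0] Least_equality)

lemma less_ordinal_1_iff [simp]: "\<alpha> < 1 \<longleftrightarrow> \<alpha> = (0 :: 'b ordinal)"
proof
  show "\<alpha> = 0" if "\<alpha> < 1"
    using not_less_Least[of \<alpha> "\<lambda>\<zeta>. 0 < \<zeta>"] that unfolding one_ordinal_def[symmetric]
    by (meson ordinal_0_le order_antisym not_less)
  show "\<alpha> < 1" if "\<alpha> = 0"
    unfolding that one_ordinal_def using ordinal_ex_greater by (metis LeastI_ex)
qed

lemma ordinal_1_neq_0 [simp]: "1 \<noteq> (0 :: 'b ordinal)"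
  by (metis less_ordinal_1_iff not_less_ordinal_0)

lemma ordinal_add_1: "\<alpha> + 1 = (LEAST \<zeta> :: 'b ordinal. \<alpha> < \<zeta>)"
proof -
  have "{..<1 :: 'b ordinal} = {0}" by auto
  moreover have "ordinal_add \<alpha> 0 = \<alpha>" using ordinal_add_0[of \<alpha>] by (simp add: plus_ordinal_def)
  ultimately have "\<alpha> + 1 = (LEAST \<zeta>. \<alpha> \<le> \<zeta> \<and> \<alpha> < \<zeta>)"
    by (simp add: plus_ordinal_def ordinal_add.simps[of \<alpha> 1])
  then show ?thesis by (simp add: less_le cong: conj_cong)
qed

lemma ordinal_less_add_1_iff: "\<beta> < \<alpha> + 1 \<longleftrightarrow> \<beta> \<le> (\<alpha> :: 'b ordinal)"
  unfolding ordinal_add_1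
  by (metis LeastI_ex Least_le leD le_less_linear not_less ordinal_ex_greater order.strict_trans1)

lemma ordinal_add_1_inject: "\<alpha> + 1 = \<beta> + 1 \<longleftrightarrow> \<alpha> = (\<beta> :: 'b ordinal)"
  by (metis ordinal_less_add_1_iff order_antisym order_refl)

lemma lessThan_ordinal_lepoll: "{..<\<alpha> :: 'b ordinal} \<lesssim> (UNIV :: ('b + nat) set)"
  by (rule lepoll_trans[OF subset_imp_lepoll atMost_ordinal_lepoll[of \<alpha>]]) auto

lemma ordinal_image_bounded:
  "\<exists>\<zeta>. \<forall>\<gamma>\<in>{..<\<beta> :: 'b ordinal}. f \<gamma> < (\<zeta> :: 'b ordinal)"
  using ordinal_bounded[OF lepoll_trans[OF image_lepoll lessThan_ordinal_lepoll[of \<beta>]], of f] by auto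

lemma ordinal_add_rec:
  "\<alpha> + \<beta> = (LEAST \<zeta> :: 'b ordinal. \<alpha> \<le> \<zeta> \<and> (\<forall>\<gamma>\<in>{..<\<beta>}. \<alpha> + \<gamma> < \<zeta>))"
  unfolding plus_ordinal_def by (rule ordinal_add.simps)

lemma ordinal_mult_rec:
  "\<alpha> * \<beta> = (LEAST \<zeta> :: 'b ordinal. \<forall>\<gamma>\<in>{..<\<beta>}. \<alpha> * \<gamma> + \<alpha> \<le> \<zeta>)"
  unfolding times_ordinal_def by (rule ordinal_mult.simps)

lemma ordinal_add_spec:
  fixes \<alpha> \<beta> :: "'b ordinal"
  shows "\<alpha> \<le> \<alpha> + \<beta>" and "\<gamma> < \<beta> \<Longrightarrow> \<alpha> + \<gamma> < \<alpha> + \<beta>"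
proof -
  obtain \<zeta> where "\<forall>\<gamma>\<in>{..<\<beta>}. \<alpha> + \<gamma> < \<zeta>" using ordinal_image_bounded by blast
  then have "\<alpha> \<le> max \<alpha> \<zeta> \<and> (\<forall>\<gamma>\<in>{..<\<beta>}. \<alpha> + \<gamma> < max \<alpha> \<zeta>)" by (auto simp: less_max_iff_disj)
  then have "\<alpha> \<le> \<alpha> + \<beta> \<and> (\<forall>\<gamma>\<in>{..<\<beta>}. \<alpha> + \<gamma> < \<alpha> + \<beta>)"
    by (subst (1 3) ordinal_add_rec) (rule LeastI)
  then show "\<alpha> \<le> \<alpha> + \<beta>" "\<gamma> < \<beta> \<Longrightarrow> \<alpha> + \<gamma> < \<alpha> + \<beta>" by auto
qed

lemma ordinal_add_succ: "\<alpha> + (\<beta> + 1) = (\<alpha> + \<beta>) + (1 :: 'b ordinal)"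
proof -
  have "(\<alpha> \<le> \<zeta> \<and> (\<forall>\<gamma>\<in>{..<\<beta> + 1}. \<alpha> + \<gamma> < \<zeta>)) \<longleftrightarrow> \<alpha> + \<beta> < \<zeta>" for \<zeta>
  proof
    assume "\<alpha> + \<beta> < \<zeta>"
    moreover have "\<alpha> + \<gamma> \<le> \<alpha> + \<beta>" if "\<gamma> \<le> \<beta>" for \<gamma>
      using that ordinal_add_spec(2)[of \<gamma> \<beta> \<alpha>] by (cases "\<gamma> = \<beta>") (auto simp: le_less)
    ultimately show "\<alpha> \<le> \<zeta> \<and> (\<forall>\<gamma>\<in>{..<\<beta> + 1}. \<alpha> + \<gamma> < \<zeta>)"
      using ordinal_add_spec(1)[of \<alpha> \<beta>]
      by (meson lessThan_iff less_imp_le order_le_less_trans ordinal_less_add_1_iff)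
  qed (simp add: ordinal_less_add_1_iff)
  then show ?thesis
    unfolding ordinal_add_1[of "\<alpha> + \<beta>"] ordinal_add_rec[of \<alpha> "\<beta> + 1"] by presburger
qed

lemma ordinal_mult_0: "\<alpha> * 0 = (0 :: 'b ordinal)"
  unfolding ordinal_mult_rec[of \<alpha> 0] by (simp add: zero_ordinal_def[symmetric])

lemma ordinal_mult_succ: "\<alpha> * (\<beta> + 1) = \<alpha> * \<beta> + (\<alpha> :: 'b ordinal)"
proof -
  obtain \<zeta> where "\<forall>\<gamma>\<in>{..<\<beta>}. \<alpha> * \<gamma> + \<alpha> < \<zeta>"
    using ordinal_image_bounded[of \<beta> "\<lambda>\<gamma>. \<alpha> * \<gamma> + \<alpha>"] by blast
  then have "\<forall>\<gamma>\<in>{..<\<beta>}. \<alpha> * \<gamma> + \<alpha> \<le> \<zeta>" by (auto simp: less_imp_le)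
  then have "\<forall>\<gamma>\<in>{..<\<beta>}. \<alpha> * \<gamma> + \<alpha> \<le> \<alpha> * \<beta>"
    by (subst (2) ordinal_mult_rec) (rule LeastI)
  then have "\<alpha> * \<gamma> + \<alpha> \<le> \<alpha> * \<beta> + \<alpha>" if "\<gamma> \<le> \<beta>" for \<gamma>
    using that ordinal_add_spec(1)[of "\<alpha> * \<beta>" \<alpha>] by (metis lessThan_iff le_less order_trans)
  then have "(LEAST \<zeta>. \<forall>\<gamma>\<in>{..<\<beta> + 1}. \<alpha> * \<gamma> + \<alpha> \<le> \<zeta>) = \<alpha> * \<beta> + \<alpha>"
    by (intro Least_equality) (auto simp: ordinal_less_add_1_iff)
  then show ?thesis
    unfolding ordinal_mult_rec[of \<alpha> "\<beta> + 1"] .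
qed


section \<open>The functions \<open>\<sigma>\<^sub>\<kappa>\<close> and \<open>\<gamma>\<^sub>\<kappa>\<close>\<close>

function ord_sigma :: "'b ordinal \<Rightarrow> 'b ordinal \<Rightarrow> 'b ordinal" where
  "ord_sigma \<kappa> \<alpha> =
    (if \<alpha> = 0 then 0
     else if \<alpha> = 1 then \<kappa>
     else if \<exists>\<beta>. \<alpha> = \<beta> + 1
       then ord_sigma \<kappa> (THE \<beta>. \<alpha> = \<beta> + 1) + card_of_ord (ord_sigma \<kappa> (THE \<beta>. \<alpha> = \<beta> + 1))
     else ord_sup (ord_sigma \<kappa> ` {..<\<alpha>}))"
  by auto
termination
proof (relation "inv_image {(x, y). x < y} snd")
  show "wf (inv_image {(x, y :: 'b ordinal). x < y} (snd :: 'b ordinal \<times> 'b ordinal \<Rightarrow> _))"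
    by (auto intro: wf)
  have "(THE \<beta>. \<alpha> = \<beta> + 1) < \<alpha>" if "\<exists>\<beta>. \<alpha> = \<beta> + 1" for \<alpha> :: "'b ordinal"
    using that by (auto simp: ordinal_add_1_inject ordinal_less_add_1_iff)
  then show
    "\<lbrakk>\<alpha> \<noteq> 0; \<alpha> \<noteq> 1; \<exists>\<beta>. \<alpha> = \<beta> + 1\<rbrakk> \<Longrightarrow>
      ((\<kappa>, THE \<beta>. \<alpha> = \<beta> + 1), (\<kappa>, \<alpha>)) \<in> inv_image {(x, y). x < y} snd"
    "\<lbrakk>\<alpha> \<noteq> 0; \<alpha> \<noteq> 1; \<exists>\<beta>. \<alpha> = \<beta> + 1\<rbrakk> \<Longrightarrow>
      ((\<kappa>, THE \<beta>. \<alpha> = \<beta> + 1), (\<kappa>, \<alpha>)) \<in> inv_image {(x, y). x < y} snd"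
    for \<kappa> \<alpha> :: "'b ordinal"
    by simp_all
qed auto

declare ord_sigma.simps [simp del]

lemma ord_sigma_0: "ord_sigma \<kappa> 0 = 0"
  by (simp add: ord_sigma.simps[of \<kappa> 0])

lemma ord_sigma_1: "ord_sigma \<kappa> 1 = \<kappa>"
  by (simp add: ord_sigma.simps[of \<kappa> 1])

lemma ord_sigma_succ:
  assumes "0 < \<alpha>"
  shows "ord_sigma \<kappa> (\<alpha> + 1) = ord_sigma \<kappa> \<alpha> + card_of_ord (ord_sigma \<kappa> \<alpha>)"
proof -
  have "\<alpha> + 1 \<noteq> 0" by (metis ordinal_less_add_1_iff ordinal_0_le leD)
  moreover have "\<alpha> + 1 \<noteq> 1"
    using assms by (metis less_ordinal_1_iff ordinal_less_add_1_iff order_refl order.strict_iff_not)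
  ultimately show ?thesis
    by (simp add: ord_sigma.simps[of \<kappa> "\<alpha> + 1"] ordinal_add_1_inject)
qed

lemma ord_sigma_limit:
  fixes \<beta> :: "'b ordinal"
  assumes "\<beta> \<noteq> 0" "\<nexists>\<alpha>. \<beta> = \<alpha> + 1"
  shows "ord_sigma \<kappa> \<beta> = ord_sup (ord_sigma \<kappa> ` {..<\<beta>})"
proof -
  have "1 = 0 + (1 :: 'b ordinal)" unfolding ordinal_add_1 by (rule one_ordinal_def)
  then have "\<beta> \<noteq> 1" using assms(2) by metis
  then show ?thesis using assms by (simp add: ord_sigma.simps[of \<kappa> \<beta>])
qed

text \<open>
  \<open>sigma_form \<kappa> \<delta> [\<alpha>\<^sub>0, \<dots>, \<alpha>\<^sub>n\<^sub>-\<^sub>1] \<Delta>\<close> says that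
  \<open>\<delta> = \<sigma>(\<alpha>\<^sub>0) + \<dots> + \<sigma>(\<alpha>\<^sub>n\<^sub>-\<^sub>1) + \<Delta>\<close> is the canonical decomposition of \<open>\<delta>\<close>.
\<close>

definition sigma_form :: "'b ordinal \<Rightarrow> 'b ordinal \<Rightarrow> 'b ordinal list \<Rightarrow> 'b ordinal \<Rightarrow> bool" where
  "sigma_form \<kappa> \<delta> as \<Delta> \<longleftrightarrow>
     \<delta> = foldr (+) (map (ord_sigma \<kappa>) as) \<Delta> \<and>
     sorted_wrt (\<lambda>\<alpha> \<beta>. card_of_ord (ord_sigma \<kappa> \<alpha>) > card_of_ord (ord_sigma \<kappa> \<beta>)) as \<and>
     (as \<noteq> [] \<longrightarrow> last as > 0) \<and>
     \<Delta> < \<kappa>"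

definition ord_gamma :: "'b ordinal \<Rightarrow> 'b ordinal \<Rightarrow> 'b ordinal" where
  "ord_gamma \<kappa> \<delta> =
     (THE \<gamma>. \<exists>as \<Delta>. sigma_form \<kappa> \<delta> as \<Delta> \<and>
        \<gamma> = (if as = [] then 0 else foldr (+) (map (ord_sigma \<kappa>) (butlast as)) 0))"


section \<open>Cardinal functions of a space\<close>

text \<open>
  All families of subsets of a space on \<open>'a\<close> have cardinality at most \<open>|'a set|\<close>, so the
  cardinal functions take values in \<open>'a set ordinal\<close>.
\<close>

definition dense_in :: "'a topology \<Rightarrow> 'a set \<Rightarrow> bool" where
  "dense_in X D \<longleftrightarrow> D \<subseteq> topspace X \<and> X closure_of D = topspace X"

definition space_density :: "'a topology \<Rightarrow> 'a set ordinal" where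
  "space_density X = (LEAST \<mu>. \<exists>D. dense_in X D \<and> \<mu> = ord_card D)"

definition nonempty_opens :: "'a topology \<Rightarrow> 'a set set" where
  "nonempty_opens X = {U. openin X U \<and> U \<noteq> {}}"

definition local_pi_base :: "'a topology \<Rightarrow> 'a \<Rightarrow> 'a set set \<Rightarrow> bool" where
  "local_pi_base X p \<R> \<longleftrightarrow>
     \<R> \<subseteq> nonempty_opens X \<and> (\<forall>U. openin X U \<and> p \<in> U \<longrightarrow> (\<exists>R\<in>\<R>. R \<subseteq> U))"

definition pi_character_at :: "'a topology \<Rightarrow> 'a \<Rightarrow> 'a set ordinal" where
  "pi_character_at X p = (LEAST \<mu>. \<exists>\<R>. local_pi_base X p \<R> \<and> \<mu> = ord_card \<R>)"

definition pi_character :: "'a topology \<Rightarrow> 'a set ordinal" where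
  "pi_character X = ord_sup (pi_character_at X ` topspace X)"


section \<open>Shapirovskii \<open>\<pi>\<close>-bases\<close>

definition left_separated :: "'a topology \<Rightarrow> 'b ordinal \<Rightarrow> ('b ordinal \<Rightarrow> 'a) \<Rightarrow> bool" where
  "left_separated X \<mu> p \<longleftrightarrow> (\<forall>\<delta><\<mu>. X closure_of (p ` {..<\<delta>}) \<inter> p ` {\<delta>..<\<mu>} = {})"

definition shapirovskii_pi_base ::
  "'a topology \<Rightarrow> ('a set ordinal \<times> 'a set ordinal \<Rightarrow> 'a set) \<Rightarrow> ('a set ordinal \<Rightarrow> 'a) \<Rightarrow> bool"
where
  "shapirovskii_pi_base X S p \<longleftrightarrow>
    (let d = space_density X; \<kappa> = max ord_omega (pi_character X) in
      S ` ({..<d} \<times> {..<\<kappa>}) \<subseteq> nonempty_opens X \<and>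
      dense_in X (p ` {..<d}) \<and>
      left_separated X d p \<and>
      (\<forall>\<alpha><d. local_pi_base X (p \<alpha>) {S (\<alpha>, i) | i. i < \<kappa>}) \<and>
      (\<forall>\<alpha><d. X closure_of (p ` {..<\<alpha>}) \<inter>
          (\<Union>{X closure_of S (\<beta>, i) | \<beta> i. \<alpha> \<le> \<beta> \<and> \<beta> < d \<and> i < \<kappa>}) = {}) \<and>
      (\<forall>\<delta> A. 0 < \<delta> \<and> \<delta> \<le> d \<and> (\<exists>\<epsilon>. \<delta> = \<kappa> * \<epsilon>) \<and>
          finite A \<and> A \<subseteq> {ord_gamma \<kappa> \<delta>..<\<delta>} \<times> {..<\<kappa>} \<and>
          topspace X \<inter> (\<Inter>a\<in>A. X closure_of S a) \<noteq> {} \<longrightarrow>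
          topspace X \<inter> (\<Inter>a\<in>A. X closure_of S a) \<inter>
            (\<Union>\<alpha>\<in>{..<\<delta>}. X closure_of (p ` {..<\<alpha>})) \<noteq> {}))"

end

theory Submission
  imports Defs
begin

text \<open>
  Let \<open>\<lambda> = d(X)\<close>. The points \<open>p \<alpha>\<close> and the sets \<open>S (\<alpha>, i)\<close> are chosen by recursion on \<open>\<alpha> < \<lambda>\<close>:
  the earlier points are not dense, so \<open>p \<alpha>\<close> can be taken outside their closure, and by regularity
  \<open>p \<alpha>\<close> has a local \<open>\<pi>\<close>-base of size at most \<open>\<kappa>\<close> whose members have closures missing that closure.
  This gives left-separation, (a) and (b). A schedule assigns to stage \<open>\<alpha>\<close> one task: a nonempty set
  that the closure of the points should meet; if it does not do so yet, \<open>p \<alpha>\<close> is picked in it.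

  For (c), each finite \<open>A \<subseteq> [\<gamma>(\<delta>), \<delta>) \<times> \<kappa>\<close> has to be scheduled at some \<open>\<alpha> < \<delta>\<close> beyond \<open>A\<close>. Write
  \<open>\<delta> = g + \<sigma>(b)\<close> with \<open>g = \<gamma>(\<delta>)\<close>. If \<open>b\<close> is a limit, \<open>A\<close> already lies below some \<open>g + \<sigma>(c)\<close>, \<open>c < b\<close>.
  If \<open>b = c + 1\<close> with \<open>c > 0\<close>, there are \<open>|\<sigma>(c)|\<close> such \<open>A\<close>, as many as ordinals in the interval
  \<open>[g + \<sigma>(c), g + \<sigma>(c + 1))\<close>, along which they can be listed, each one cofinally. These
  intervals overlap, but an ordinal lies only in those coming from prefixes of its canonical
  decomposition, so it receives finitely many wishes, and the wishes of a block of length \<open>\<kappa>\<close> can be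
  rearranged within the block, one at a time.
\<close>

section \<open>Ordinal addition\<close>

lemma ordinal_add_less_iff [simp]: "a + b < a + c \<longleftrightarrow> b < (c :: 'b ordinal)"
  using ordinal_add_spec(2)[of b c a] ordinal_add_spec(2)[of c b a] by (metis less_asym not_less_iff_gr_or_eq)

lemma ordinal_add_le_iff [simp]: "a + b \<le> a + c \<longleftrightarrow> b \<le> (c :: 'b ordinal)"
  by (simp flip: not_less)

lemma ordinal_add_cancel [simp]: "a + b = a + c \<longleftrightarrow> b = (c :: 'b ordinal)"
  by (metis order_antisym ordinal_add_le_iff order_refl)

lemma ordinal_add_least:
  assumes "a \<le> z" "\<And>c. c < b \<Longrightarrow> a + c < z"
  shows "a + b \<le> (z :: 'b ordinal)"
  unfolding ordinal_add_rec[of a b] by (rule Least_le) (use assms in auto)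

lemma ordinal_le_add_self: "b \<le> a + (b :: 'b ordinal)"
proof (induction b rule: less_induct)
  case (less b)
  then have "c < a + b" if "c < b" for c
    using that ordinal_add_spec(2)[of c b a] by (meson order_le_less_trans)
  then show ?case by (meson leI less_irrefl)
qed

text \<open>Left subtraction: for the least \<open>z\<close> with \<open>y \<le> x + z\<close>, all
  \<open>c < z\<close> satisfy \<open>x + c < y\<close>, so \<open>x + z \<le> y\<close> as
  well.\<close>

lemma ordinal_le_imp_add:
  assumes "x \<le> (y :: 'b ordinal)"
  obtains z where "y = x + z"
proof
  let ?z = "LEAST z. y \<le> x + z"
  have 1: "y \<le> x + ?z" by (rule LeastI[of _ y]) (rule ordinal_le_add_self)
  have "x + ?z \<le> y"
    by (rule ordinal_add_least) (use assms not_less_Least not_less in blast)+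
  with 1 show "y = x + ?z" by simp
qed

lemma ordinal_add_assoc: "(a + b) + c = a + (b + (c :: 'b ordinal))"
proof (induction c rule: less_induct)
  case (less c)
  have "a + x < a + b + c" if x: "x < b + c" for x
  proof (cases "x < b")
    case True
    then have "a + x < a + b" by simp
    then show ?thesis by (meson ordinal_add_spec(1) order_less_le_trans)
  next
    case False
    then obtain z where z: "x = b + z" using ordinal_le_imp_add not_less by metis
    then have "z < c" using x by simp
    then show ?thesis using less z by (metis ordinal_add_less_iff)
  qed
  then have "a + (b + c) \<le> a + b + c"
    by (intro ordinal_add_least) (meson ordinal_add_spec(1) order_trans)
  moreover have "a + b + c \<le> a + (b + c)"
    by (rule ordinal_add_least) (use less in \<open>auto simp: ordinal_add_spec\<close>)
  ultimately show ?case by simp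
qed

lemma ordinal_0_add [simp]: "0 + b = (b :: 'b ordinal)"
proof (induction b rule: less_induct)
  case (less b)
  then have "0 + b \<le> b" by (intro ordinal_add_least) auto
  then show ?case by (meson ordinal_le_add_self order_antisym)
qed

lemma ordinal_zero_less_iff: "0 < (a :: 'b ordinal) \<longleftrightarrow> a \<noteq> 0"
  by (simp add: less_le)

lemma lessThan_ordinal_add: "{..<a + b} = {..<a} \<union> (+) a ` {..<(b :: 'b ordinal)}"
proof -
  have "x \<in> {..<a} \<union> (+) a ` {..<b}" if "x < a + b" for x
  proof (cases "x < a")
    case False
    then obtain z where "x = a + z" using ordinal_le_imp_add not_less by metis
    then show ?thesis using that by auto
  qed simp
  moreover have "x < a + b" if "x < a" for x
    using that ordinal_add_spec(1) by (meson order_less_le_trans)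
  ultimately show ?thesis by auto
qed

text \<open>Stands in for \<open>\<delta>\<close> being a multiple of \<open>\<mu>\<close>.\<close>

definition add_closed :: "'b ordinal \<Rightarrow> 'b ordinal \<Rightarrow> bool" where
  "add_closed \<mu> \<delta> \<longleftrightarrow> (\<forall>x<\<delta>. \<forall>i<\<mu>. x + i < \<delta>)"

text \<open>\<open>\<mu> * \<epsilon>\<close> is the supremum of the ordinals
  \<open>\<mu> * c + \<mu>\<close> with \<open>c < \<epsilon>\<close>. Below such a bound, either
  the induction hypothesis for \<open>c\<close> applies or \<open>x\<close> is
  \<open>\<mu> * c\<close> plus an offset below \<open>\<mu>\<close>.\<close>

lemma add_closed_mult:
  assumes "add_closed \<mu> \<mu>"
  shows "add_closed \<mu> (\<mu> * \<epsilon>)"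
proof (induction \<epsilon> rule: less_induct)
  case (less \<epsilon>)
  show ?case unfolding add_closed_def
  proof (intro allI impI)
    fix x i assume x: "x < \<mu> * \<epsilon>" and i: "i < \<mu>"
    have "\<exists>c<\<epsilon>. x < \<mu> * c + \<mu>"
    proof (rule ccontr)
      assume "\<not> ?thesis"
      then have "\<mu> * \<epsilon> \<le> x"
        unfolding ordinal_mult_rec[of \<mu> \<epsilon>] by (intro Least_le ballI) (metis lessThan_iff not_less)
      with x show False by simp
    qed
    then obtain c where c: "c < \<epsilon>" "x < \<mu> * c + \<mu>" by blast
    obtain \<zeta> where \<zeta>: "\<forall>c\<in>{..<\<epsilon>}. \<mu> * c + \<mu> < \<zeta>"
      using ordinal_image_bounded[of \<epsilon> "\<lambda>c. \<mu> * c + \<mu>"] by blast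
    have "\<forall>c\<in>{..<\<epsilon>}. \<mu> * c + \<mu> \<le> \<mu> * \<epsilon>"
      unfolding ordinal_mult_rec[of \<mu> \<epsilon>]
      by (rule LeastI[of _ \<zeta>]) (use \<zeta> in \<open>auto simp: less_imp_le\<close>)
    then have le: "\<mu> * c + \<mu> \<le> \<mu> * \<epsilon>" using c(1) by auto
    have "x + i < \<mu> * c + \<mu>"
    proof (cases "x < \<mu> * c")
      case True
      then have "x + i < \<mu> * c" using less[OF c(1)] i by (auto simp: add_closed_def)
      then show ?thesis by (meson ordinal_add_spec(1) order_less_le_trans)
    next
      case False
      then obtain j where j: "x = \<mu> * c + j" using ordinal_le_imp_add not_less by metis
      then have "j < \<mu>" using c(2) by simp
      then have "j + i < \<mu>" using assms i by (auto simp: add_closed_def)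
      then show ?thesis by (simp add: j ordinal_add_assoc)
    qed
    then show "x + i < \<mu> * \<epsilon>" using le by (rule order_less_le_trans)
  qed
qed

section \<open>Initial ordinals\<close>

lemma card_of_ord_eqpoll: "{..<card_of_ord (a :: 'b ordinal)} \<approx> {..<a}"
  by (rule ord_card_eqpoll[OF lessThan_ordinal_lepoll])

text \<open>Schroeder-Bernstein: an \<open>a\<close> below \<open>ord_card A\<close> with
  \<open>A \<lesssim> {..<a}\<close> would be equipollent to \<open>A\<close>, against minimality.
  The assumption ensures that the minimum exists.\<close>

lemma ord_card_le_iff:
  assumes "A \<lesssim> (UNIV :: ('b + nat) set)"
  shows "ord_card A \<le> (a :: 'b ordinal) \<longleftrightarrow> A \<lesssim> {..<a}"
proof
  assume "ord_card A \<le> a"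
  then have "{..<ord_card A :: 'b ordinal} \<lesssim> {..<a}" by (intro subset_imp_lepoll) auto
  then show "A \<lesssim> {..<a}"
    using ord_card_eqpoll[OF assms] lepoll_trans1 eqpoll_sym by blast
next
  assume *: "A \<lesssim> {..<a}"
  show "ord_card A \<le> a"
  proof (rule ccontr)
    assume "\<not> ord_card A \<le> a"
    then have "{..<a} \<subseteq> {..<ord_card A}" by auto
    then have "{..<a} \<lesssim> A"
      using ord_card_eqpoll[OF assms] lepoll_trans2 subset_imp_lepoll by blast
    then have "{..<a} \<approx> A" using * lepoll_antisym by blast
    then have "ord_card A \<le> a" unfolding ord_card_def by (rule Least_le)
    with \<open>\<not> ord_card A \<le> a\<close> show False by simp
  qed
qed

lemma card_of_ord_le_iff: "card_of_ord x \<le> y \<longleftrightarrow> {..<x} \<lesssim> {..<y :: 'b ordinal}"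
  by (rule ord_card_le_iff[OF lessThan_ordinal_lepoll])

lemma card_of_ord_le_self: "card_of_ord x \<le> (x :: 'b ordinal)"
  by (simp add: card_of_ord_le_iff)

lemma card_of_ord_mono: "x \<le> y \<Longrightarrow> card_of_ord x \<le> card_of_ord (y :: 'b ordinal)"
  unfolding card_of_ord_le_iff
  by (meson card_of_ord_eqpoll eqpoll_sym lepoll_trans2 subset_imp_lepoll lessThan_subset_iff)

definition infinite_cardinal :: "'b ordinal \<Rightarrow> bool" where
  "infinite_cardinal \<mu> \<longleftrightarrow> infinite {..<\<mu>} \<and> card_of_ord \<mu> = \<mu>"

lemma card_of_ord_ord_card:
  assumes "A \<lesssim> (UNIV :: ('b + nat) set)"
  shows "card_of_ord (ord_card A) = (ord_card A :: 'b ordinal)"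
proof (rule order_antisym)
  have "{..<ord_card A :: 'b ordinal} \<approx> A" by (rule ord_card_eqpoll[OF assms])
  then show "ord_card A \<le> card_of_ord (ord_card A :: 'b ordinal)"
    unfolding ord_card_le_iff[OF assms]
    by (meson card_of_ord_eqpoll eqpoll_imp_lepoll eqpoll_sym eqpoll_trans)
qed (rule card_of_ord_le_self)

lemma infinite_cardinal_ord_card:
  assumes "A \<lesssim> (UNIV :: ('b + nat) set)" "infinite A"
  shows "infinite_cardinal (ord_card A :: 'b ordinal)"
  unfolding infinite_cardinal_def
  using card_of_ord_ord_card[OF assms(1)] ord_card_eqpoll[OF assms(1)] assms(2) eqpoll_finite_iff
  by metis

lemma infinite_cardinal_card_of_ord:
  "infinite {..<x} \<Longrightarrow> infinite_cardinal (card_of_ord (x :: 'b ordinal))"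
  by (rule infinite_cardinal_ord_card[OF lessThan_ordinal_lepoll])

text \<open>An initial ordinal does not separate \<open>x\<close> from its cardinality. This links
  bounds on remainders with the decrease of cardinalities in canonical decompositions.\<close>

lemma less_card_of_ord_iff:
  "x < card_of_ord y \<longleftrightarrow> card_of_ord x < card_of_ord (y :: 'b ordinal)"
proof -
  have "card_of_ord y \<le> x \<longleftrightarrow> card_of_ord y \<le> card_of_ord x"
    unfolding card_of_ord_le_iff
    by (meson card_of_ord_eqpoll eqpoll_sym lepoll_trans2)
  then show ?thesis by (simp add: not_le[symmetric])
qed

lemma less_infinite_cardinal_iff:
  assumes "infinite_cardinal \<mu>"
  shows "x < \<mu> \<longleftrightarrow> {..<x} \<prec> {..<\<mu>}"
proof -
  have "\<mu> \<le> x \<longleftrightarrow> {..<\<mu>} \<lesssim> {..<x}"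
    using assms card_of_ord_le_iff[of \<mu> x] by (simp add: infinite_cardinal_def)
  moreover have "{..<x} \<lesssim> {..<\<mu>}" if "x < \<mu>"
    using that by (intro subset_imp_lepoll) auto
  ultimately show ?thesis
    unfolding lesspoll_def using lepoll_antisym by (metis eqpoll_imp_lepoll eqpoll_sym not_less)
qed

section \<open>Arithmetic of infinite cardinalities\<close>

lemma lesspoll_iff_card_of_ordLess: "A \<prec> B \<longleftrightarrow> |A| <o |B|"
  unfolding lesspoll_def
  by (metis eqpoll_iff_card_of_ordIso lepoll_iff_card_of_ordLeq ordLeq_iff_ordLess_or_ordIso
      not_ordLess_ordIso)

lemma Un_lesspoll_infinite:
  "infinite C \<Longrightarrow> A \<prec> C \<Longrightarrow> B \<prec> C \<Longrightarrow> A \<union> B \<prec> C"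
  unfolding lesspoll_iff_card_of_ordLess by (rule card_of_Un_ordLess_infinite)

lemma Un_lepoll_infinite:
  "infinite C \<Longrightarrow> A \<lesssim> C \<Longrightarrow> B \<lesssim> C \<Longrightarrow> A \<union> B \<lesssim> C"
  unfolding lepoll_iff_card_of_ordLeq
  using card_of_Un_ordLeq_infinite_Field[OF _ _ _ card_of_Card_order] by (metis Field_card_of)

lemma UN_lepoll_infinite:
  "infinite C \<Longrightarrow> I \<lesssim> C \<Longrightarrow> (\<And>i. i \<in> I \<Longrightarrow> A i \<lesssim> C) \<Longrightarrow> (\<Union>i\<in>I. A i) \<lesssim> C"
  unfolding lepoll_iff_card_of_ordLeq by (rule card_of_UNION_ordLeq_infinite) auto

lemma Times_lepoll_infinite:
  assumes "infinite C" "A \<lesssim> C" "B \<lesssim> C"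
  shows "A \<times> B \<lesssim> C"
proof -
  have "C \<times> C \<approx> C"
    using card_of_Times_same_infinite[OF assms(1)] by (simp add: eqpoll_iff_card_of_ordIso)
  then show ?thesis
    using times_lepoll_mono[OF assms(2,3)] lepoll_trans2 by blast
qed

text \<open>Sets of size \<open>n + 1\<close> arise from pairs of an element and a set of size
  \<open>n\<close>, so each size contributes at most \<open>|C|\<close> sets, and there are
  countably many sizes.\<close>

lemma Fpow_lepoll_infinite:
  assumes "infinite C" "A \<lesssim> C"
  shows "{F. finite F \<and> F \<subseteq> A} \<lesssim> C"
proof -
  have "{F. finite F \<and> F \<subseteq> A \<and> card F = n} \<lesssim> C" for n
  proof (induction n)
    case 0
    have "{F. finite F \<and> F \<subseteq> A \<and> card F = 0} = {{}}" by auto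
    then show ?case using assms(1) by (simp add: finite_lepoll_infinite)
  next
    case (Suc n)
    have "F \<in> (\<lambda>(x, F). insert x F) ` (A \<times> {F. finite F \<and> F \<subseteq> A \<and> card F = n})"
      if F: "finite F" "F \<subseteq> A" "card F = Suc n" for F
    proof -
      obtain x G where "F = insert x G" "x \<notin> G" "card G = n"
        using F(3) card_Suc_eq by metis
      then show ?thesis using F(1,2) by (intro image_eqI[of _ _ "(x, G)"]) auto
    qed
    then have "{F. finite F \<and> F \<subseteq> A \<and> card F = Suc n} \<subseteq>
        (\<lambda>(x, F). insert x F) ` (A \<times> {F. finite F \<and> F \<subseteq> A \<and> card F = n})"
      by blast
    moreover have "A \<times> {F. finite F \<and> F \<subseteq> A \<and> card F = n} \<lesssim> C"
      by (rule Times_lepoll_infinite[OF assms Suc])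
    ultimately show ?case by (meson lepoll_trans subset_image_lepoll)
  qed
  moreover have "{F. finite F \<and> F \<subseteq> A} = (\<Union>n\<in>(UNIV :: nat set). {F. finite F \<and> F \<subseteq> A \<and> card F = n})"
    by auto
  moreover have "(UNIV :: nat set) \<lesssim> C" using assms(1) infinite_le_lepoll by blast
  ultimately show ?thesis
    by (simp only: UN_lepoll_infinite[OF assms(1)])
qed

text \<open>By \<open>lessThan_ordinal_add\<close>, \<open>{..<x + i}\<close> is the union of two
  sets of cardinality less than \<open>\<mu>\<close>.\<close>

lemma infinite_cardinal_add_closed:
  assumes "infinite_cardinal \<mu>"
  shows "add_closed \<mu> \<mu>"
  unfolding add_closed_def
proof (intro allI impI)
  fix x i assume "x < \<mu>" "i < \<mu>"
  then have "{..<x} \<prec> {..<\<mu>}" "{..<i} \<prec> {..<\<mu>}"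
    using assms less_infinite_cardinal_iff by auto
  moreover have "(+) x ` {..<i} \<lesssim> {..<i}" by (rule image_lepoll)
  ultimately have "{..<x + i} \<prec> {..<\<mu>}"
    using assms unfolding lessThan_ordinal_add infinite_cardinal_def
    by (meson Un_lesspoll_infinite lesspoll_trans1)
  then show "x + i < \<mu>" using assms less_infinite_cardinal_iff by auto
qed

lemma infinite_lessThan_gt_1:
  assumes "infinite {..<\<mu> :: 'b ordinal}"
  shows "1 < \<mu>"
proof (rule ccontr)
  assume "\<not> 1 < \<mu>"
  then have "{..<\<mu>} \<subseteq> {0}" by (auto simp flip: less_ordinal_1_iff)
  then show False using assms finite_subset by blast
qed

text \<open>Tasks must recur beyond every bound because one can be served only after all sets it
  mentions have been chosen.\<close>

definition cofinal :: "'b ordinal \<Rightarrow> 't set \<Rightarrow> ('b ordinal \<Rightarrow> 't) \<Rightarrow> bool" where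
  "cofinal \<mu> T f \<longleftrightarrow> (\<forall>w\<in>T. \<forall>x<\<mu>. \<exists>x'<\<mu>. x < x' \<and> f x' = w)"

text \<open>Positions are decoded by an injection of \<open>F \<times> {..<\<mu>}\<close> into
  \<open>{..<\<mu>}\<close>, keeping the first coordinate. Each \<open>w\<close> then has
  \<open>\<mu>\<close> positions, too many to fit below \<open>x + 1 < \<mu>\<close>.\<close>

lemma cofinal_enumeration:
  fixes \<mu> :: "'b ordinal"
  assumes \<mu>: "infinite_cardinal \<mu>" and F: "F \<lesssim> {..<\<mu>}"
  shows "\<exists>g. cofinal \<mu> F g"
proof -
  have inf: "infinite {..<\<mu>}" using \<mu> by (simp add: infinite_cardinal_def)
  have "F \<times> {..<\<mu>} \<lesssim> {..<\<mu>}" by (rule Times_lepoll_infinite[OF inf F lepoll_refl])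
  then obtain e where e: "inj_on e (F \<times> {..<\<mu>})" "e ` (F \<times> {..<\<mu>}) \<subseteq> {..<\<mu>}"
    by (auto simp: lepoll_def)
  define g where "g y = fst (inv_into (F \<times> {..<\<mu>}) e y)" for y
  have "\<exists>x'<\<mu>. x < x' \<and> g x' = w" if w: "w \<in> F" and x: "x < \<mu>" for w x
  proof (rule ccontr)
    assume n: "\<not> (\<exists>x'<\<mu>. x < x' \<and> g x' = w)"
    have "(\<lambda>y. e (w, y)) ` {..<\<mu>} \<subseteq> {..<x + 1}"
    proof clarsimp
      fix y assume y: "y < \<mu>"
      have "g (e (w, y)) = w" unfolding g_def using e(1) w y by (simp add: inv_into_f_f)
      moreover have "e (w, y) < \<mu>" using e(2) w y by auto
      ultimately show "e (w, y) < x + 1" using n ordinal_less_add_1_iff not_less by metis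
    qed
    moreover have "inj_on (\<lambda>y. e (w, y)) {..<\<mu>}"
      using e(1) w by (auto simp: inj_on_def)
    ultimately have "{..<\<mu>} \<lesssim> {..<x + 1}" unfolding lepoll_def by blast
    moreover have "x + 1 < \<mu>"
      using infinite_cardinal_add_closed[OF \<mu>] x infinite_lessThan_gt_1[OF inf]
      by (auto simp: add_closed_def)
    ultimately show False using less_infinite_cardinal_iff[OF \<mu>]
      by (meson lesspoll_not_refl lesspoll_trans1)
  qed
  then have "cofinal \<mu> F g" by (simp add: cofinal_def)
  then show ?thesis by (intro exI[of _ g])
qed

section \<open>The function \<open>\<sigma>\<^sub>\<kappa>\<close> and canonical decompositions\<close>

lemma ord_sup_upper:
  assumes "\<And>x. x \<in> A \<Longrightarrow> x \<le> z" "x \<in> A"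
  shows "x \<le> ord_sup (A :: 'b ordinal set)"
proof -
  have "\<forall>x\<in>A. x \<le> ord_sup A"
    unfolding ord_sup_def by (rule LeastI[of _ z]) (use assms(1) in auto)
  then show ?thesis using assms(2) by blast
qed

lemma ord_sup_least:
  "(\<And>x. x \<in> A \<Longrightarrow> x \<le> z) \<Longrightarrow> ord_sup A \<le> (z :: 'b ordinal)"
  unfolding ord_sup_def by (intro Least_le) auto

lemma ordinal_add_1_le_iff: "a + 1 \<le> b \<longleftrightarrow> a < (b :: 'b ordinal)"
  by (metis ordinal_less_add_1_iff not_less)

lemma ordinal_cases [case_names zero succ limit]:
  fixes b :: "'b ordinal"
  obtains "b = 0" | c where "b = c + 1" | "b \<noteq> 0" "\<nexists>c. b = c + 1" "\<And>c. c < b \<Longrightarrow> c + 1 < b"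
  by (metis ordinal_add_1_le_iff order_le_less)

locale sigma_kappa =
  fixes \<kappa> :: "'b ordinal"
  assumes \<kappa>: "infinite_cardinal \<kappa>"
begin

abbreviation \<sigma> :: "'b ordinal \<Rightarrow> 'b ordinal" where
  "\<sigma> \<equiv> ord_sigma \<kappa>"

lemma infinite_\<kappa>: "infinite {..<\<kappa>}" and card_\<kappa>: "card_of_ord \<kappa> = \<kappa>"
  using \<kappa> by (auto simp: infinite_cardinal_def)

lemma \<kappa>_gt_1: "1 < \<kappa>"
  by (rule infinite_lessThan_gt_1[OF infinite_\<kappa>])

lemma \<kappa>_pos: "0 < \<kappa>"
  using \<kappa>_gt_1 ordinal_0_le order_le_less_trans by blast

lemma sigma_limit_upper:
  assumes "b \<noteq> 0" "\<nexists>c. b = c + 1" "c < b"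
  shows "\<sigma> c \<le> \<sigma> b"
proof -
  obtain \<zeta> where "\<forall>c\<in>{..<b}. \<sigma> c < \<zeta>" using ordinal_image_bounded by blast
  then show ?thesis
    unfolding ord_sigma_limit[OF assms(1,2)]
    by (intro ord_sup_upper[of _ \<zeta>]) (use assms(3) in \<open>auto intro: less_imp_le\<close>)
qed

lemma sigma_ge_\<kappa>: "0 < a \<Longrightarrow> \<kappa> \<le> \<sigma> a"
proof (induction a rule: less_induct)
  case (less a)
  show ?case
  proof (cases a rule: ordinal_cases)
    case (succ c)
    show ?thesis
    proof (cases "c = 0")
      case True
      then show ?thesis using succ by (simp add: ord_sigma_1)
    next
      case False
      then have "\<kappa> \<le> \<sigma> c"
        using less succ by (simp add: ordinal_less_add_1_iff ordinal_zero_less_iff)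
      then show ?thesis
        using succ False ord_sigma_succ[of c \<kappa>] ordinal_add_spec(1) ordinal_zero_less_iff
        by (metis order_trans)
    qed
  next
    case limit
    then have "1 < a" using limit(3)[of 0] less(2) by simp
    then have "\<sigma> 1 \<le> \<sigma> a" using limit sigma_limit_upper by blast
    then show ?thesis by (simp add: ord_sigma_1)
  qed (use less in simp)
qed

lemma infinite_sigma:
  assumes "0 < a"
  shows "infinite {..<\<sigma> a}"
proof -
  have "{..<\<kappa>} \<subseteq> {..<\<sigma> a}" using sigma_ge_\<kappa>[OF assms] by auto
  then show ?thesis using infinite_\<kappa> finite_subset by blast
qed

lemma infinite_cardinal_card_sigma: "0 < a \<Longrightarrow> infinite_cardinal (card_of_ord (\<sigma> a))"
  by (rule infinite_cardinal_card_of_ord[OF infinite_sigma])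

lemma \<kappa>_le_card_sigma: "0 < a \<Longrightarrow> \<kappa> \<le> card_of_ord (\<sigma> a)"
  using card_of_ord_mono[OF sigma_ge_\<kappa>] card_\<kappa> by metis

lemma card_sigma_pos: "0 < a \<Longrightarrow> 0 < card_of_ord (\<sigma> a)"
  using \<kappa>_le_card_sigma \<kappa>_pos by (meson order_less_le_trans)

lemma sigma_less_succ: "\<sigma> a < \<sigma> (a + 1)"
proof (cases "a = 0")
  case True
  then show ?thesis by (simp add: ord_sigma_0 ord_sigma_1 \<kappa>_pos)
next
  case False
  then have "0 < a" by (simp add: ordinal_zero_less_iff)
  then show ?thesis
    using ord_sigma_succ[of a \<kappa>] card_sigma_pos[of a] ordinal_add_less_iff[of "\<sigma> a" 0] by simp
qed

lemma sigma_strict_mono: "a < b \<Longrightarrow> \<sigma> a < \<sigma> b"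
proof (induction b rule: less_induct)
  case (less b)
  show ?case
  proof (cases b rule: ordinal_cases)
    case (succ c)
    then have "\<sigma> a \<le> \<sigma> c"
      using less by (metis order_le_less order_refl ordinal_less_add_1_iff)
    then show ?thesis using succ sigma_less_succ[of c] by (auto intro: order_le_less_trans)
  next
    case limit
    then show ?thesis
      using less(2) sigma_less_succ[of a] sigma_limit_upper[of b "a + 1"]
      by (auto intro: order_less_le_trans)
  qed (use less in simp)
qed

lemma sigma_less_iff: "\<sigma> a < \<sigma> b \<longleftrightarrow> a < b"
  by (metis less_asym not_less_iff_gr_or_eq sigma_strict_mono)

lemma sigma_le_iff: "\<sigma> a \<le> \<sigma> b \<longleftrightarrow> a \<le> b"
  using sigma_less_iff by (simp flip: not_less)

text \<open>True of every strictly increasing map; it shows that the values of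
  \<open>\<sigma>\<close> are unbounded.\<close>

lemma le_sigma: "b \<le> \<sigma> b"
proof (induction b rule: less_induct)
  case (less b)
  have "c < \<sigma> b" if "c < b" for c
    using less[OF that] sigma_strict_mono[OF that] by (rule order_le_less_trans)
  then show ?case by (meson leI less_irrefl)
qed

lemma sigma_limit_cofinal:
  assumes "b \<noteq> 0" "\<nexists>c. b = c + 1" "x < \<sigma> b"
  shows "\<exists>c<b. x < \<sigma> c"
proof (rule ccontr)
  assume n: "\<not> ?thesis"
  have "\<sigma> c \<le> x" if "c < b" for c
  proof (rule ccontr)
    assume "\<not> \<sigma> c \<le> x"
    then show False using n that by (simp add: not_le)
  qed
  then have "\<sigma> b \<le> x"
    unfolding ord_sigma_limit[OF assms(1,2)] by (intro ord_sup_least) auto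
  then show False using assms(3) by simp
qed

text \<open>The least \<open>c\<close> with \<open>x < \<sigma> c\<close> is not 0 and, by
  continuity of \<open>\<sigma>\<close>, not a limit; its predecessor is \<open>b\<close>.\<close>

lemma sigma_interval:
  obtains b where "\<sigma> b \<le> x" "x < \<sigma> (b + 1)"
proof -
  define c where "c = (LEAST c. x < \<sigma> c)"
  have "x < \<sigma> (x + 1)"
    using le_sigma[of "x + 1"] by (simp add: ordinal_add_1_le_iff)
  then have c: "x < \<sigma> c" unfolding c_def by (rule LeastI)
  have least: "\<sigma> d \<le> x" if "d < c" for d
    using not_less_Least[of d "\<lambda>c. x < \<sigma> c"] that by (auto simp: c_def)
  show ?thesis
  proof (cases c rule: ordinal_cases)
    case zero
    then show ?thesis using c by (simp add: ord_sigma_0)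
  next
    case (succ b)
    then show ?thesis using that[of b] c least[of b] by (simp add: ordinal_less_add_1_iff)
  next
    case limit
    then show ?thesis using sigma_limit_cofinal[OF limit(1,2) c] least by (metis not_less)
  qed
qed

section \<open>Existence and uniqueness of canonical decompositions\<close>

abbreviation sigma_sum :: "'b ordinal list \<Rightarrow> 'b ordinal \<Rightarrow> 'b ordinal" where
  "sigma_sum as \<Delta> \<equiv> foldr (+) (map \<sigma> as) \<Delta>"

lemma sigma_sum_append_0: "sigma_sum as \<Delta> = sigma_sum as 0 + \<Delta>"
  by (induction as) (simp_all add: ordinal_add_assoc)

lemma sigma_sum_append: "sigma_sum (as @ bs) \<Delta> = sigma_sum as 0 + sigma_sum bs \<Delta>"
  by (induction as) (simp_all add: ordinal_add_assoc)

abbreviation canonical :: "'b ordinal list \<Rightarrow> bool" where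
  "canonical as \<equiv>
     sorted_wrt (\<lambda>\<alpha> \<beta>. card_of_ord (\<sigma> \<alpha>) > card_of_ord (\<sigma> \<beta>)) as \<and> (as \<noteq> [] \<longrightarrow> last as > 0)"

lemma sigma_form_iff:
  "sigma_form \<kappa> \<delta> as \<Delta> \<longleftrightarrow> canonical as \<and> \<Delta> < \<kappa> \<and> \<delta> = sigma_sum as \<Delta>"
  by (auto simp: sigma_form_def)

lemma card_sigma_less_imp_less: "card_of_ord (\<sigma> a) < card_of_ord (\<sigma> b) \<Longrightarrow> a < b"
  by (metis card_of_ord_mono leD leI sigma_le_iff)

text \<open>Only the last index is required to be positive; going left, the cardinalities and hence
  the indices increase.\<close>

lemma canonical_pos: "canonical as \<Longrightarrow> a \<in> set as \<Longrightarrow> 0 < a"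
proof (induction as)
  case (Cons x as)
  show ?case
  proof (cases "as = []")
    case False
    then have "hd as \<in> set as" by simp
    moreover have "0 < last as" using Cons.prems False by simp
    ultimately have "card_of_ord (\<sigma> (hd as)) < card_of_ord (\<sigma> x)" using Cons.prems by auto
    then have "hd as < x" by (rule card_sigma_less_imp_less)
    then have "0 < x" using ordinal_0_le order_le_less_trans by blast
    then show ?thesis using Cons False by auto
  qed (use Cons.prems in simp)
qed simp

lemma canonical_Cons: "canonical (a # as) \<Longrightarrow> canonical as"
  by (cases "as = []") auto

text \<open>\<open>{..<\<sigma> (a + 1)}\<close> is the union of two sets of the cardinality of
  \<open>\<sigma> a\<close>. Hence the interval from \<open>\<sigma> a\<close> to
  \<open>\<sigma> (a + 1)\<close> is long enough to list all tasks below its own end.\<close>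

lemma card_sigma_succ:
  assumes "0 < a"
  shows "card_of_ord (\<sigma> (a + 1)) = card_of_ord (\<sigma> a)"
proof (rule order_antisym)
  let ?m = "card_of_ord (\<sigma> a)"
  have inf: "infinite {..<?m}"
    using infinite_cardinal_card_sigma[OF assms] by (simp add: infinite_cardinal_def)
  have "(+) (\<sigma> a) ` {..<?m} \<lesssim> {..<?m}" by (rule image_lepoll)
  moreover have "{..<\<sigma> a} \<lesssim> {..<?m}"
    using card_of_ord_eqpoll eqpoll_imp_lepoll eqpoll_sym by blast
  ultimately have "{..<\<sigma> (a + 1)} \<lesssim> {..<?m}"
    unfolding ord_sigma_succ[OF assms] lessThan_ordinal_add
    by (intro Un_lepoll_infinite[OF inf])
  then show "card_of_ord (\<sigma> (a + 1)) \<le> ?m" by (simp add: card_of_ord_le_iff)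
  show "?m \<le> card_of_ord (\<sigma> (a + 1))"
    by (rule card_of_ord_mono) (simp add: sigma_less_succ less_imp_le)
qed

text \<open>By induction, a remainder with head \<open>b\<close> stays below
  \<open>\<sigma> (b + 1)\<close>, which has the cardinality of \<open>\<sigma> b\<close>, smaller
  than that of \<open>\<sigma> a\<close>. So a decomposition with head \<open>a\<close> lies between
  \<open>\<sigma> a\<close> and \<open>\<sigma> (a + 1)\<close>.\<close>

lemma sigma_sum_less_card:
  assumes "canonical (a # as)" "\<Delta> < \<kappa>"
  shows "sigma_sum as \<Delta> < card_of_ord (\<sigma> a)"
  using assms
proof (induction as arbitrary: a)
  case Nil
  then show ?case using \<kappa>_le_card_sigma[of a] by (auto intro: order_less_le_trans)
next
  case (Cons b as)
  have b: "0 < b" using Cons.prems canonical_pos by (meson list.set_intros)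
  have "sigma_sum as \<Delta> < card_of_ord (\<sigma> b)"
    using Cons canonical_Cons by blast
  then have "sigma_sum (b # as) \<Delta> < \<sigma> (b + 1)" by (simp add: ord_sigma_succ[OF b])
  then have "card_of_ord (sigma_sum (b # as) \<Delta>) \<le> card_of_ord (\<sigma> b)"
    using card_of_ord_mono less_imp_le card_sigma_succ[OF b] by metis
  also have "\<dots> < card_of_ord (\<sigma> a)" using Cons.prems by simp
  finally show ?case using less_card_of_ord_iff by blast
qed

text \<open>Converse to \<open>sigma_sum_less_card\<close>: the leading term of a nonempty
  \<open>as\<close> is at most \<open>r\<close>, so its cardinality is below that of
  \<open>\<sigma> b\<close>.\<close>

lemma canonical_ConsI:
  assumes "sigma_form \<kappa> r as \<Delta>" "r < card_of_ord (\<sigma> b)" "0 < b"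
  shows "canonical (b # as)"
proof -
  have "card_of_ord (\<sigma> a) < card_of_ord (\<sigma> b)" if a: "a \<in> set as" for a
  proof -
    have "card_of_ord (\<sigma> a) \<le> card_of_ord (\<sigma> (hd as))"
      using assms(1) a by (cases as) (auto simp: sigma_form_iff less_imp_le)
    also have "\<sigma> (hd as) \<le> r"
      using assms(1) a ordinal_add_spec(1) by (cases as) (auto simp: sigma_form_iff)
    then have "card_of_ord (\<sigma> (hd as)) \<le> card_of_ord r" by (rule card_of_ord_mono)
    also have "\<dots> < card_of_ord (\<sigma> b)" using assms(2) less_card_of_ord_iff by blast
    finally show ?thesis .
  qed
  then show ?thesis using assms(1,3) by (auto simp: sigma_form_iff)
qed

text \<open>Greedy choice: peel off the largest \<open>\<sigma> b \<le> x\<close>. The remainder is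
  below \<open>card_of_ord (\<sigma> b)\<close>, hence below \<open>x\<close>.\<close>

lemma sigma_form_ex: "\<exists>as \<Delta>. sigma_form \<kappa> x as \<Delta>"
proof (induction x rule: less_induct)
  case (less x)
  show ?case
  proof (cases "x < \<kappa>")
    case True
    then have "sigma_form \<kappa> x [] x" by (simp add: sigma_form_iff)
    then show ?thesis by blast
  next
    case False
    obtain b where b: "\<sigma> b \<le> x" "x < \<sigma> (b + 1)" by (rule sigma_interval)
    have "b \<noteq> 0" using False b by (auto simp: ord_sigma_1)
    then have b0: "0 < b" by (simp add: ordinal_zero_less_iff)
    obtain r where r: "x = \<sigma> b + r" using b(1) ordinal_le_imp_add by blast
    then have rb: "r < card_of_ord (\<sigma> b)" using b(2) by (simp add: ord_sigma_succ[OF b0])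
    then have "r < x" using card_of_ord_le_self b(1) by (meson order_less_le_trans order_trans)
    then obtain as \<Delta> where as: "sigma_form \<kappa> r as \<Delta>" using less by blast
    then have "sigma_form \<kappa> x (b # as) \<Delta>"
      using r canonical_ConsI[OF as rb b0] by (simp add: sigma_form_iff)
    then show ?thesis by blast
  qed
qed

lemma sigma_form_unique:
  assumes "sigma_form \<kappa> x as \<Delta>" "sigma_form \<kappa> x bs \<Gamma>"
  shows "as = bs \<and> \<Delta> = \<Gamma>"
proof -
  \<comment> \<open>The interval of \<open>\<sigma>\<close> containing the sum determines the
    leading index. A sum with a leading term is at least \<open>\<kappa>\<close>, so it cannot equal
    a mere offset.\<close>
  have bounds: "0 < a \<and> \<sigma> a \<le> sigma_sum (a # as) \<Delta> \<and> sigma_sum (a # as) \<Delta> < \<sigma> (a + 1)"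
    if "canonical (a # as)" "\<Delta> < \<kappa>" for a as \<Delta>
  proof -
    have a: "0 < a" using canonical_pos[OF that(1)] by simp
    show ?thesis
      using a sigma_sum_less_card[OF that] by (simp add: ordinal_add_spec(1) ord_sigma_succ[OF a])
  qed
  have "as = bs \<and> \<Delta> = \<Gamma>"
    if "canonical as" "canonical bs" "\<Delta> < \<kappa>" "\<Gamma> < \<kappa>" "sigma_sum as \<Delta> = sigma_sum bs \<Gamma>" for as bs
    using that
  proof (induction as bs rule: list_induct2')
    case 1
    then show ?case by simp
  next
    case (2 a as)
    have "\<kappa> \<le> sigma_sum (a # as) \<Delta>"
      using bounds[OF 2(1,3)] sigma_ge_\<kappa>[of a] by (blast intro: order_trans)
    then show ?case using 2 by simp
  next
    case (3 b bs)
    have "\<kappa> \<le> sigma_sum (b # bs) \<Gamma>"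
      using bounds[OF 3(2,4)] sigma_ge_\<kappa>[of b] by (blast intro: order_trans)
    then show ?case using 3 by simp
  next
    case (4 a as b bs)
    have "\<sigma> a < \<sigma> (b + 1)" "\<sigma> b < \<sigma> (a + 1)"
      using bounds[OF 4(2,4)] bounds[OF 4(3,5)] 4(6) by (metis order_le_less_trans)+
    then have "a = b" by (simp add: sigma_less_iff ordinal_less_add_1_iff)
    moreover from this have "sigma_sum as \<Delta> = sigma_sum bs \<Gamma>" using 4(6) by simp
    ultimately show ?case
      using 4(1)[OF canonical_Cons[OF 4(2)] canonical_Cons[OF 4(3)] 4(4,5)] by simp
  qed
  then show ?thesis using assms by (auto simp: sigma_form_iff)
qed

lemma ord_gamma_eq:
  assumes "sigma_form \<kappa> \<delta> as \<Delta>"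
  shows "ord_gamma \<kappa> \<delta> = (if as = [] then 0 else sigma_sum (butlast as) 0)"
  unfolding ord_gamma_def
proof (rule the_equality)
  show "\<exists>bs \<Gamma>. sigma_form \<kappa> \<delta> bs \<Gamma> \<and>
      (if as = [] then 0 else sigma_sum (butlast as) 0) = (if bs = [] then 0 else sigma_sum (butlast bs) 0)"
    using assms by blast
qed (use sigma_form_unique[OF assms] in blast)

text \<open>A nonzero offset \<open>\<Delta>\<close> would violate closure at
  \<open>sigma_sum as 0\<close>. So \<open>\<delta>\<close> is its \<open>ord_gamma\<close> plus one
  last term \<open>\<sigma> b\<close>, and scheduling can proceed by induction on
  \<open>b\<close>.\<close>

lemma add_closed_sigma_form:
  assumes "add_closed \<kappa> \<delta>" "0 < \<delta>"
  obtains bs b where "canonical (bs @ [b])" "\<delta> = sigma_sum bs 0 + \<sigma> b"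
    "ord_gamma \<kappa> \<delta> = sigma_sum bs 0"
proof -
  obtain as \<Delta> where as: "sigma_form \<kappa> \<delta> as \<Delta>" using sigma_form_ex by blast
  then have \<delta>: "\<delta> = sigma_sum as 0 + \<Delta>" "\<Delta> < \<kappa>"
    using sigma_sum_append_0[of as \<Delta>] by (auto simp: sigma_form_iff)
  have "\<Delta> = 0"
  proof (rule ccontr)
    assume "\<Delta> \<noteq> 0"
    then have "sigma_sum as 0 < \<delta>"
      using \<delta> ordinal_add_less_iff[of "sigma_sum as 0" 0 \<Delta>] by (simp add: ordinal_zero_less_iff)
    then show False using assms(1) \<delta> by (metis add_closed_def less_irrefl)
  qed
  then have "as \<noteq> []" using \<delta>(1) assms(2) by (intro notI) simp
  then obtain bs b where bs: "as = bs @ [b]" by (metis append_butlast_last_id)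
  show ?thesis
  proof
    show "canonical (bs @ [b])" using as bs by (simp add: sigma_form_iff)
    show "\<delta> = sigma_sum bs 0 + \<sigma> b" using \<delta>(1) sigma_sum_append[of bs "[b]" 0] unfolding \<open>\<Delta> = 0\<close> bs by simp
    show "ord_gamma \<kappa> \<delta> = sigma_sum bs 0" using ord_gamma_eq[OF as] bs by simp
  qed
qed

end

section \<open>Scheduling the tasks\<close>

context sigma_kappa
begin

lemma canonical_append_left: "canonical (bs @ as) \<Longrightarrow> canonical bs"
  using canonical_pos[of "bs @ as"] by (auto simp: sorted_wrt_append)

lemma canonical_append_Cons:
  assumes "canonical (bs @ [c])" "canonical (c # xs)"
  shows "canonical (bs @ c # xs)"
  using assms by (fastforce simp: sorted_wrt_append)

text \<open>Lets the scheduling pass from \<open>b\<close> to a smaller index over the same initial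
  part \<open>bs\<close>.\<close>

lemma canonical_replace_last:
  assumes "canonical (bs @ [b])" "card_of_ord (\<sigma> c) \<le> card_of_ord (\<sigma> b)" "0 < c"
  shows "canonical (bs @ [c])"
  using assms by (auto simp: sorted_wrt_append intro: order_le_less_trans)

text \<open>With \<open>g = ord_gamma \<kappa> \<delta>\<close> and
  \<open>g + \<tau> = \<delta>\<close> these are the index sets of condition (c).\<close>

definition tasks :: "'b ordinal \<Rightarrow> 'b ordinal \<Rightarrow> ('b ordinal \<times> 'b ordinal) set set" where
  "tasks g \<tau> = {A. finite A \<and> A \<subseteq> {g..<g + \<tau>} \<times> {..<\<kappa>}}"

lemma tasks_lepoll:
  assumes "0 < c"
  shows "tasks g (\<sigma> c) \<lesssim> {..<card_of_ord (\<sigma> c)}"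
proof -
  let ?m = "{..<card_of_ord (\<sigma> c)}"
  have inf: "infinite ?m"
    using infinite_cardinal_card_sigma[OF assms] by (simp add: infinite_cardinal_def)
  have "{g..<g + \<sigma> c} \<subseteq> (+) g ` {..<\<sigma> c}"
  proof
    fix x assume x: "x \<in> {g..<g + \<sigma> c}"
    then obtain z where "x = g + z" using ordinal_le_imp_add by auto
    with x show "x \<in> (+) g ` {..<\<sigma> c}" by auto
  qed
  then have "{g..<g + \<sigma> c} \<lesssim> {..<\<sigma> c}" by (rule subset_image_lepoll)
  then have "{g..<g + \<sigma> c} \<lesssim> ?m"
    using card_of_ord_eqpoll eqpoll_sym lepoll_trans2 by blast
  moreover have "{..<\<kappa>} \<lesssim> ?m"
    using \<kappa>_le_card_sigma[OF assms] by (intro subset_imp_lepoll) auto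
  ultimately show ?thesis
    unfolding tasks_def by (intro Fpow_lepoll_infinite[OF inf] Times_lepoll_infinite[OF inf])
qed

lemma tasks_bounded:
  assumes "A \<in> tasks g \<tau>" "0 < \<tau>"
  shows "\<exists>m<\<tau>. \<forall>a\<in>A. fst a \<le> g + m"
proof (cases "A = {}")
  case False
  have fin: "finite (fst ` A)" "fst ` A \<noteq> {}" using assms False by (auto simp: tasks_def)
  then have "Max (fst ` A) \<in> fst ` A" by (rule Max_in)
  then have "g \<le> Max (fst ` A)" "Max (fst ` A) < g + \<tau>" using assms(1) by (auto simp: tasks_def)
  moreover then obtain m where "Max (fst ` A) = g + m" using ordinal_le_imp_add by metis
  ultimately show ?thesis using fin Max_ge by (metis image_eqI ordinal_add_less_iff)
qed (use assms in auto)

text \<open>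
  \<open>Inl x\<close> is the request to bring the \<open>x\<close>-th point of a dense set into the closure of the points
  chosen so far, \<open>Inr A\<close> the request to make that closure meet the intersection indexed by \<open>A\<close>.
\<close>

lemma schedule_exists:
  obtains h :: "'b ordinal \<Rightarrow> 'b ordinal + ('b ordinal \<times> 'b ordinal) set"
  where "\<And>\<delta> x. add_closed \<kappa> \<delta> \<Longrightarrow> x < \<delta> \<Longrightarrow> \<exists>\<alpha><\<delta>. h \<alpha> = Inl x"
    and "\<And>\<delta> A. 0 < \<delta> \<Longrightarrow> add_closed \<kappa> \<delta> \<Longrightarrow> finite A \<Longrightarrow>
      A \<subseteq> {ord_gamma \<kappa> \<delta>..<\<delta>} \<times> {..<\<kappa>} \<Longrightarrow> \<exists>\<alpha><\<delta>. h \<alpha> = Inr A \<and> A \<subseteq> {..<\<alpha>} \<times> {..<\<kappa>}"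
proof -
  \<comment> \<open>Write \<open>g\<close> for \<open>sigma_sum bs 0\<close>. Position
    \<open>x\<close> of \<open>f bs c\<close> stands for the ordinal
    \<open>g + \<sigma> c + x\<close>. The tasks listed are all those between \<open>g\<close> and
    \<open>g + \<sigma> (c + 1)\<close>.\<close>
  define f where "f bs c = (SOME f. cofinal (card_of_ord (\<sigma> c)) (tasks (sigma_sum bs 0) (\<sigma> (c + 1))) f)"
    for bs c
  have f: "cofinal (card_of_ord (\<sigma> c)) (tasks (sigma_sum bs 0) (\<sigma> (c + 1))) (f bs c)"
    if c: "0 < c" for bs c
  proof -
    have "0 < c + 1" by (simp add: ordinal_less_add_1_iff)
    then have "tasks (sigma_sum bs 0) (\<sigma> (c + 1)) \<lesssim> {..<card_of_ord (\<sigma> c)}"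
      using tasks_lepoll[of "c + 1"] card_sigma_succ[OF c] by simp
    from cofinal_enumeration[OF infinite_cardinal_card_sigma[OF c] this]
    show ?thesis unfolding f_def by (rule someI_ex)
  qed
  \<comment> \<open>The tasks wished for in the block of ordinals \<open>sigma_sum as \<Delta>\<close> with \<open>\<Delta> < \<kappa>\<close>. Those of an
    interval from \<open>\<sigma> c\<close> to \<open>\<sigma> (c + 1)\<close> above \<open>bs\<close> come from a prefix \<open>bs @ [c]\<close> of \<open>as\<close>; there are
    only finitely many prefixes, so at most \<open>\<kappa>\<close> tasks, which the block itself can enumerate.\<close>
  define V where "V as = Inl ` (+) (sigma_sum as 0) ` {..<\<kappa>} \<union> Inr ` tasks (sigma_sum as 0) \<kappa> \<union>
    (\<Union>n\<in>{..<length as}. (\<lambda>\<Delta>. Inr (f (take n as) (as ! n) (sigma_sum (drop (Suc n) as) \<Delta>))) ` {..<\<kappa>})"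
    for as
  define F where "F as = (SOME F. cofinal \<kappa> (V as) F)" for as
  have "V as \<lesssim> {..<\<kappa>}" for as
  proof -
    have "tasks (sigma_sum as 0) \<kappa> \<lesssim> {..<\<kappa>}"
      using tasks_lepoll[of 1 "sigma_sum as 0"] by (simp add: ord_sigma_1 card_\<kappa> ordinal_zero_less_iff)
    moreover have "{..<length as} \<lesssim> {..<\<kappa>}" using infinite_\<kappa> by (simp add: finite_lepoll_infinite)
    ultimately show ?thesis
      unfolding V_def
      by (intro Un_lepoll_infinite[OF infinite_\<kappa>] UN_lepoll_infinite[OF infinite_\<kappa>])
        (auto intro: image_lepoll lepoll_trans[OF image_lepoll])
  qed
  from cofinal_enumeration[OF \<kappa> this]
  have F: "cofinal \<kappa> (V as) (F as)" for as
    unfolding F_def by (rule someI_ex)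
  \<comment> \<open>The canonical decomposition of \<open>\<alpha>\<close> gives its block
    \<open>as\<close> and its position \<open>\<Delta>\<close> in that block; uniqueness makes the
    choice determinate.\<close>
  define h where "h \<alpha> = (case SOME p. sigma_form \<kappa> \<alpha> (fst p) (snd p) of (as, \<Delta>) \<Rightarrow> F as \<Delta>)" for \<alpha>
  have h: "h (sigma_sum as 0 + \<Delta>) = F as \<Delta>" if "canonical as" "\<Delta> < \<kappa>" for as \<Delta>
  proof -
    have form: "sigma_form \<kappa> (sigma_sum as 0 + \<Delta>) as \<Delta>"
      using that sigma_sum_append_0[of as \<Delta>] by (simp add: sigma_form_iff)
    have "(SOME p. sigma_form \<kappa> (sigma_sum as 0 + \<Delta>) (fst p) (snd p)) = (as, \<Delta>)"
    proof (rule some_equality)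
      fix p assume "sigma_form \<kappa> (sigma_sum as 0 + \<Delta>) (fst p) (snd p)"
      then show "p = (as, \<Delta>)" using sigma_form_unique[OF form, of "fst p" "snd p"] by (simp add: prod_eq_iff)
    qed (use form in simp)
    then show ?thesis by (simp add: h_def)
  qed
  have hit: "\<exists>\<Delta>'<\<kappa>. \<Delta> < \<Delta>' \<and> h (sigma_sum as 0 + \<Delta>') = v"
    if "canonical as" "\<Delta> < \<kappa>" "v \<in> V as" for as \<Delta> v
    using F[of as] h[OF that(1)] that(2,3) by (metis cofinal_def)
  \<comment> \<open>\<open>Inl x\<close> is served in the block of \<open>x\<close> itself, which
    starts at or below \<open>x\<close> and lies below \<open>\<delta>\<close> by closure under
    adding ordinals less than \<open>\<kappa>\<close>.\<close>
  have Inl_hit: "\<exists>\<alpha><\<delta>. h \<alpha> = Inl x" if \<delta>: "add_closed \<kappa> \<delta>" "x < \<delta>" for \<delta> x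
  proof -
    obtain as \<Delta> where "sigma_form \<kappa> x as \<Delta>" using sigma_form_ex by blast
    then have x: "canonical as" "\<Delta> < \<kappa>" "x = sigma_sum as 0 + \<Delta>"
      using sigma_sum_append_0[of as \<Delta>] by (auto simp: sigma_form_iff)
    then have "Inl x \<in> V as" by (auto simp: V_def)
    then obtain \<Delta>' where \<Delta>': "\<Delta>' < \<kappa>" "h (sigma_sum as 0 + \<Delta>') = Inl x" using hit x by blast
    have "sigma_sum as 0 \<le> x" using x(3) ordinal_add_spec(1) by simp
    then have "sigma_sum as 0 < \<delta>" using \<delta>(2) by (rule order_le_less_trans)
    then have "sigma_sum as 0 + \<Delta>' < \<delta>" using \<delta>(1) \<Delta>'(1) by (simp add: add_closed_def)
    then show ?thesis using \<Delta>'(2) by blast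
  qed
  have Inr_hit: "\<exists>\<alpha><sigma_sum bs 0 + \<sigma> b. h \<alpha> = Inr A \<and> (\<forall>a\<in>A. fst a < \<alpha>)"
    if "canonical (bs @ [b])" "A \<in> tasks (sigma_sum bs 0) (\<sigma> b)" for bs b A
    using that
  proof (induction b rule: less_induct)
    case (less b)
    let ?g = "sigma_sum bs 0"
    have b: "0 < b" using canonical_pos[OF less(2)] by simp
    have "0 < \<sigma> b" using sigma_ge_\<kappa>[OF b] \<kappa>_pos by (rule order_less_le_trans[rotated])
    then obtain m where m: "m < \<sigma> b" "\<And>a. a \<in> A \<Longrightarrow> fst a \<le> ?g + m"
      using tasks_bounded[OF less(3)] by blast
    have below: "fst a < ?g + y" if "m < y" "a \<in> A" for y a
      using order_le_less_trans[OF m(2)[OF that(2)]] that(1) by simp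
    show ?case
    proof (cases b rule: ordinal_cases)
      case zero
      then show ?thesis using b by simp
    next
      case (succ c)
      show ?thesis
      proof (cases "c = 0")
        case True
        then have "\<sigma> b = \<kappa>" using succ by (simp add: ord_sigma_1)
        \<comment> \<open>The first interval has no positive \<open>c\<close> to list along. Its
          tasks are at most \<open>\<kappa>\<close> many and belong to the block \<open>bs\<close>
          itself.\<close>
        then have V: "Inr A \<in> V bs" and "m < \<kappa>" using less(3) m by (auto simp: V_def)
        obtain \<Delta>' where \<Delta>': "\<Delta>' < \<kappa>" "m < \<Delta>'" "h (?g + \<Delta>') = Inr A"
          using hit[OF canonical_append_left[OF less(2)] \<open>m < \<kappa>\<close> V] by blast
        then have "?g + \<Delta>' < ?g + \<sigma> b" using \<open>\<sigma> b = \<kappa>\<close> by simp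
        then show ?thesis using \<Delta>' below[OF \<Delta>'(2)] by blast
      next
        case False
        then have c: "0 < c" by (simp add: ordinal_zero_less_iff)
        have \<sigma>b: "\<sigma> b = \<sigma> c + card_of_ord (\<sigma> c)" using succ ord_sigma_succ[OF c] by simp
        \<comment> \<open>Take the offset of \<open>m\<close> above \<open>\<sigma> c\<close>, or 0
          if \<open>m < \<sigma> c\<close>. Positions after \<open>x\<close> then stand for ordinals
          beyond \<open>?g + m\<close>.\<close>
        have "\<exists>x<card_of_ord (\<sigma> c). m \<le> \<sigma> c + x"
        proof (cases "m < \<sigma> c")
          case True
          then show ?thesis using card_sigma_pos[OF c] by (auto intro: less_imp_le)
        next
          case False
          then obtain x where "m = \<sigma> c + x" using ordinal_le_imp_add not_less by metis
          then show ?thesis using m(1) \<sigma>b by auto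
        qed
        then obtain x where x: "x < card_of_ord (\<sigma> c)" "m \<le> \<sigma> c + x" by blast
        obtain x' where x': "x' < card_of_ord (\<sigma> c)" "x < x'" "f bs c x' = A"
          using f[OF c, of bs] less(3) x(1) unfolding cofinal_def succ by blast
        \<comment> \<open>The wish sits at \<open>?g + \<sigma> c + x'\<close>, which has the
          decomposition \<open>bs @ c # xs\<close> with offset \<open>\<Delta>\<close>. It is
          granted at a later offset \<open>\<Delta>'\<close> of that block, hence still beyond
          \<open>A\<close>, and still below \<open>?g + \<sigma> b\<close> by
          \<open>sigma_sum_less_card\<close>.\<close>
        obtain xs \<Delta> where form: "sigma_form \<kappa> x' xs \<Delta>" using sigma_form_ex by blast
        have cxs: "canonical (c # xs)" by (rule canonical_ConsI[OF form x'(1) c])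
        have "canonical (bs @ [c])"
          using canonical_replace_last[OF less(2) _ c] succ card_sigma_succ[OF c] by simp
        then have can: "canonical (bs @ c # xs)" using cxs by (rule canonical_append_Cons)
        have \<Delta>: "\<Delta> < \<kappa>" "x' = sigma_sum xs \<Delta>" using form by (auto simp: sigma_form_iff)
        have "Inr A \<in> V (bs @ c # xs)"
          unfolding V_def using x'(3) \<Delta>
          by (intro UnI2 UN_I[of "length bs"] image_eqI[of _ _ \<Delta>]) auto
        then obtain \<Delta>' where \<Delta>': "\<Delta>' < \<kappa>" "\<Delta> < \<Delta>'" "h (sigma_sum (bs @ c # xs) 0 + \<Delta>') = Inr A"
          using hit[OF can \<Delta>(1)] by blast
        have eq: "sigma_sum (bs @ c # xs) 0 + \<Delta>' = ?g + (\<sigma> c + sigma_sum xs \<Delta>')"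
          using sigma_sum_append_0[of "bs @ c # xs" \<Delta>'] sigma_sum_append[of bs "c # xs" \<Delta>'] by simp
        have "sigma_sum xs \<Delta>' < card_of_ord (\<sigma> c)" by (rule sigma_sum_less_card[OF cxs \<Delta>'(1)])
        then have upper: "?g + (\<sigma> c + sigma_sum xs \<Delta>') < ?g + \<sigma> b" by (simp add: \<sigma>b)
        have "x' < sigma_sum xs \<Delta>'"
          using \<Delta>'(2) sigma_sum_append_0[of xs \<Delta>] sigma_sum_append_0[of xs \<Delta>'] \<Delta>(2) by simp
        then have "\<sigma> c + x < \<sigma> c + sigma_sum xs \<Delta>'" using x'(2) by simp
        then have "m < \<sigma> c + sigma_sum xs \<Delta>'" using x(2) by (rule order_le_less_trans[rotated])
        then show ?thesis using upper \<Delta>'(3) below unfolding eq by blast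
      qed
    next
      case limit
      \<comment> \<open>By continuity the bound \<open>m\<close> lies below some
        \<open>\<sigma> c\<close> with \<open>c < b\<close>, so \<open>A\<close> is already a task
        for \<open>c\<close>.\<close>
      obtain c where c: "c < b" "m < \<sigma> c" using sigma_limit_cofinal[OF limit(1,2) m(1)] by blast
      then have "c \<noteq> 0" using ord_sigma_0[of \<kappa>] by (intro notI) simp
      then have "canonical (bs @ [c])"
        using c(1) by (intro canonical_replace_last[OF less(2)] card_of_ord_mono)
          (auto simp: sigma_le_iff ordinal_zero_less_iff)
      moreover have "a \<in> {?g..<?g + \<sigma> c} \<times> {..<\<kappa>}" if a: "a \<in> A" for a
      proof -
        have "fst a < ?g + \<sigma> c" using c(2) a by (rule below)
        then show ?thesis using less(3) a by (cases a) (auto simp: tasks_def)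
      qed
      then have "A \<in> tasks ?g (\<sigma> c)" using less(3) by (auto simp: tasks_def)
      ultimately obtain \<alpha> where "\<alpha> < ?g + \<sigma> c" "h \<alpha> = Inr A \<and> (\<forall>a\<in>A. fst a < \<alpha>)"
        using less(1)[OF c(1)] by blast
      moreover have "?g + \<sigma> c < ?g + \<sigma> b" using sigma_strict_mono[OF c(1)] by simp
      ultimately show ?thesis using order_less_trans by blast
    qed
  qed
  show ?thesis
  proof (rule that[of h])
    show "\<exists>\<alpha><\<delta>. h \<alpha> = Inl x" if "add_closed \<kappa> \<delta>" "x < \<delta>" for \<delta> x
      using that by (rule Inl_hit)
    show "\<exists>\<alpha><\<delta>. h \<alpha> = Inr A \<and> A \<subseteq> {..<\<alpha>} \<times> {..<\<kappa>}"
      if \<delta>: "0 < \<delta>" "add_closed \<kappa> \<delta>" and A: "finite A" "A \<subseteq> {ord_gamma \<kappa> \<delta>..<\<delta>} \<times> {..<\<kappa>}" for \<delta> A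
    proof -
      obtain bs b where bs: "canonical (bs @ [b])" "\<delta> = sigma_sum bs 0 + \<sigma> b"
          "ord_gamma \<kappa> \<delta> = sigma_sum bs 0"
        using add_closed_sigma_form[OF \<delta>(2,1)] by blast
      then have "A \<in> tasks (sigma_sum bs 0) (\<sigma> b)" using A by (simp add: tasks_def)
      then obtain \<alpha> where "\<alpha> < \<delta>" "h \<alpha> = Inr A" "\<forall>a\<in>A. fst a < \<alpha>"
        using Inr_hit[OF bs(1)] bs(2) by blast
      moreover from this A(2) have "A \<subseteq> {..<\<alpha>} \<times> {..<\<kappa>}" by force
      ultimately show ?thesis by blast
    qed
  qed
qed

end

section \<open>Cardinal functions\<close>

text \<open>This lemma and the next ensure that \<open>ord_card\<close>, valued in
  \<open>'a set ordinal\<close>, is the true cardinality of a set of points or a family of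
  sets.\<close>

lemma set_lepoll_set_plus_nat: "(A :: 'a set) \<lesssim> (UNIV :: ('a set + nat) set)"
proof -
  have "inj_on (\<lambda>x. Inl {x} :: 'a set + nat) A" by (auto simp: inj_on_def)
  then show ?thesis unfolding lepoll_def by blast
qed

lemma family_lepoll_set_plus_nat: "(\<R> :: 'a set set) \<lesssim> (UNIV :: ('a set + nat) set)"
proof -
  have "inj_on (Inl :: 'a set \<Rightarrow> 'a set + nat) \<R>" by (auto simp: inj_on_def)
  then show ?thesis unfolding lepoll_def by blast
qed

lemma nat_lepoll_plus_nat: "(UNIV :: nat set) \<lesssim> (UNIV :: ('b + nat) set)"
proof -
  have "inj (Inr :: nat \<Rightarrow> 'b + nat)" by (auto simp: inj_on_def)
  then show ?thesis unfolding lepoll_def by blast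
qed

lemma infinite_cardinal_omega: "infinite_cardinal (ord_omega :: 'b ordinal)"
  unfolding ord_omega_def by (rule infinite_cardinal_ord_card[OF nat_lepoll_plus_nat]) simp

lemma infinite_cardinal_iff: "infinite_cardinal \<mu> \<longleftrightarrow> ord_omega \<le> \<mu> \<and> card_of_ord \<mu> = (\<mu> :: 'b ordinal)"
proof
  assume \<mu>: "infinite_cardinal \<mu>"
  then have "(UNIV :: nat set) \<lesssim> {..<\<mu>}"
    using infinite_le_lepoll[of "{..<\<mu>}"] by (simp add: infinite_cardinal_def)
  then have "ord_omega \<le> \<mu>"
    unfolding ord_omega_def ord_card_le_iff[OF nat_lepoll_plus_nat] .
  then show "ord_omega \<le> \<mu> \<and> card_of_ord \<mu> = \<mu>"
    using \<mu> by (simp add: infinite_cardinal_def)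
next
  assume \<mu>: "ord_omega \<le> \<mu> \<and> card_of_ord \<mu> = \<mu>"
  then have "{..<ord_omega} \<subseteq> {..<\<mu>}" by auto
  then have "infinite {..<\<mu>}"
    using infinite_cardinal_omega finite_subset unfolding infinite_cardinal_def by blast
  then show "infinite_cardinal \<mu>" using \<mu> by (simp add: infinite_cardinal_def)
qed

text \<open>Each member is its own cardinality, hence at most that of the supremum, which is
  therefore an upper bound.\<close>

lemma card_of_ord_ord_sup:
  assumes "\<And>x. x \<in> A \<Longrightarrow> x \<le> z" "\<And>x. x \<in> A \<Longrightarrow> card_of_ord x = x"
  shows "card_of_ord (ord_sup A) = (ord_sup A :: 'b ordinal)"
proof (rule order_antisym[OF card_of_ord_le_self])
  show "ord_sup A \<le> card_of_ord (ord_sup A)"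
  proof (rule ord_sup_least)
    fix x assume x: "x \<in> A"
    have "x \<le> ord_sup A" using assms(1) x by (rule ord_sup_upper)
    then have "card_of_ord x \<le> card_of_ord (ord_sup A)" by (rule card_of_ord_mono)
    then show "x \<le> card_of_ord (ord_sup A)" using assms(2)[OF x] by simp
  qed
qed

section \<open>Density and \<pi>-character as attained minima and suprema\<close>

lemma space_density_attained:
  fixes X :: "'a topology"
  shows "\<exists>D. dense_in X D \<and> space_density X = ord_card D"
proof -
  have "dense_in X (topspace X)" by (simp add: dense_in_def)
  then have "\<exists>\<mu> D. dense_in X D \<and> \<mu> = (ord_card D :: 'a set ordinal)" by blast
  then show ?thesis unfolding space_density_def by (rule LeastI_ex)
qed

text \<open>Used contrapositively: the points chosen before a stage below the density are not dense,
  so the recursion can continue.\<close>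

lemma space_density_le:
  assumes "dense_in X D" "D \<lesssim> {..<\<alpha>}"
  shows "space_density X \<le> \<alpha>"
proof -
  have "space_density X \<le> ord_card D"
    unfolding space_density_def by (rule Least_le) (use assms(1) in blast)
  also have "\<dots> \<le> \<alpha>" using assms(2) by (simp add: ord_card_le_iff[OF set_lepoll_set_plus_nat])
  finally show ?thesis .
qed

lemma pi_character_at_attained:
  fixes X :: "'a topology"
  shows "\<exists>\<R>. local_pi_base X p \<R> \<and> pi_character_at X p = ord_card \<R>"
proof -
  have "local_pi_base X p (nonempty_opens X)" by (auto simp: local_pi_base_def nonempty_opens_def)
  then have "\<exists>\<mu> \<R>. local_pi_base X p \<R> \<and> \<mu> = (ord_card \<R> :: 'a set ordinal)" by blast
  then show ?thesis unfolding pi_character_at_def by (rule LeastI_ex)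
qed

lemma pi_character_at_bounded:
  fixes X :: "'a topology"
  shows "\<exists>z. \<forall>p\<in>topspace X. pi_character_at X p < z"
proof -
  have "pi_character_at X ` topspace X \<lesssim> (UNIV :: ('a set + nat) set)"
    by (rule lepoll_trans[OF image_lepoll set_lepoll_set_plus_nat])
  from ordinal_bounded[OF this] obtain z where "\<forall>\<alpha>\<in>pi_character_at X ` topspace X. \<alpha> < z" ..
  then have "\<forall>p\<in>topspace X. pi_character_at X p < z" by (simp only: ball_simps)
  then show ?thesis ..
qed

lemma pi_character_at_le:
  assumes "p \<in> topspace X"
  shows "pi_character_at X p \<le> pi_character X"
proof -
  from pi_character_at_bounded[of X] obtain z where "\<forall>p\<in>topspace X. pi_character_at X p < z" ..
  then show ?thesis
    unfolding pi_character_def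
    by (intro ord_sup_upper[of _ z]) (use assms in \<open>auto intro: less_imp_le\<close>)
qed

lemma infinite_cardinal_max_pi_character:
  "infinite_cardinal (max ord_omega (pi_character X))"
proof -
  from pi_character_at_bounded[of X] obtain z where z: "\<forall>p\<in>topspace X. pi_character_at X p < z" ..
  have "card_of_ord (pi_character_at X p) = pi_character_at X p" for p
    using pi_character_at_attained[of X p] card_of_ord_ord_card[OF family_lepoll_set_plus_nat] by metis
  then have "card_of_ord (pi_character X) = pi_character X"
    unfolding pi_character_def
    by (intro card_of_ord_ord_sup[of _ z]) (use z in \<open>auto intro: less_imp_le\<close>)
  then show ?thesis
    using infinite_cardinal_omega by (auto simp: infinite_cardinal_iff max_def)
qed

text \<open>Regularity gives an open \<open>V\<close> around \<open>q\<close> whose closure misses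
  \<open>C\<close>. The members of a local \<pi>-base inside \<open>V\<close> still form one, as any
  open \<open>U\<close> around \<open>q\<close> may be shrunk to
  \<open>U \<inter> V\<close>.\<close>

lemma local_pi_base_within:
  assumes reg: "regular_space X" and C: "closedin X C" and q: "q \<in> topspace X - C"
    and \<kappa>: "pi_character X \<le> \<kappa>" "0 < \<kappa>"
  obtains s where "local_pi_base X q {s i | i. i < \<kappa>}" "\<And>i. i < \<kappa> \<Longrightarrow> X closure_of (s i) \<inter> C = {}"
proof -
  from pi_character_at_attained[of X q]
  obtain \<R> where \<R>: "local_pi_base X q \<R>" "pi_character_at X q = ord_card \<R>"
    by (elim exE conjE)
  from reg[unfolded regular_space, rule_format, OF conjI[OF C q]]
  obtain V where V: "openin X V" "q \<in> V" "disjnt C (X closure_of V)"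
    by (elim exE conjE)
  define \<Q> where "\<Q> = {R \<in> \<R>. R \<subseteq> V}"
  have \<Q>: "local_pi_base X q \<Q>"
    unfolding local_pi_base_def
  proof (intro conjI allI impI)
    show "\<Q> \<subseteq> nonempty_opens X" using \<R>(1) by (auto simp: local_pi_base_def \<Q>_def)
    fix U assume "openin X U \<and> q \<in> U"
    then have "openin X (U \<inter> V)" "q \<in> U \<inter> V" using V by auto
    then obtain R where "R \<in> \<R>" "R \<subseteq> U \<inter> V"
      using \<R>(1) unfolding local_pi_base_def by blast
    then show "\<exists>R\<in>\<Q>. R \<subseteq> U" unfolding \<Q>_def by blast
  qed
  then obtain R0 where R0: "R0 \<in> \<Q>" using V unfolding local_pi_base_def by blast
  have "ord_card \<R> \<le> \<kappa>" using pi_character_at_le[of q X] q \<kappa>(1) \<R>(2) by auto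
  then have "\<R> \<lesssim> {..<\<kappa>}" by (simp add: ord_card_le_iff[OF family_lepoll_set_plus_nat])
  then obtain g where g: "\<R> \<subseteq> g ` {..<\<kappa>}" unfolding lepoll_iff by blast
  \<comment> \<open>\<open>R0\<close> fills the indices at which \<open>g\<close> gives no member of
    \<open>\<Q>\<close>, so that all of \<open>{..<\<kappa>}\<close> is used.\<close>
  define s where "s i = (if g i \<in> \<Q> then g i else R0)" for i
  have s_in: "s i \<in> \<Q>" for i using R0 by (simp add: s_def)
  have "{s i | i. i < \<kappa>} = \<Q>"
  proof (intro subset_antisym subsetI)
    fix R assume R: "R \<in> \<Q>"
    then obtain i where "i < \<kappa>" "R = g i" using g by (auto simp: \<Q>_def)
    then show "R \<in> {s i | i. i < \<kappa>}" using R by (auto simp: s_def)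
  qed (use s_in in auto)
  moreover have "X closure_of (s i) \<inter> C = {}" for i
  proof -
    have "s i \<subseteq> V" using s_in[of i] by (simp add: \<Q>_def)
    then show ?thesis using V(3) closure_of_mono[of "s i" V X] by (auto simp: disjnt_iff)
  qed
  ultimately show ?thesis using that[of s] \<Q> by simp
qed

section \<open>The construction\<close>

lemma add_closed_imp_le: "add_closed \<kappa> \<delta> \<Longrightarrow> 0 < \<delta> \<Longrightarrow> \<kappa> \<le> \<delta>"
  unfolding add_closed_def by (metis not_less ordinal_0_add less_irrefl)

text \<open>Works for any schedule \<open>h\<close> and any points \<open>d\<close>. If the set
  requested at \<open>\<alpha>\<close> misses the closure of the earlier points, each of its points
  is a legitimate choice of \<open>p \<alpha>\<close>; otherwise the request is already met.\<close>

lemma left_separated_sequence_exists: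
  fixes X :: "'a topology" and \<kappa> :: "'a set ordinal" and d :: "'b \<Rightarrow> 'a"
    and h :: "'a set ordinal \<Rightarrow> 'b + ('a set ordinal \<times> 'a set ordinal) set"
  assumes reg: "regular_space X" and \<kappa>: "pi_character X \<le> \<kappa>" "0 < \<kappa>"
  obtains p :: "'a set ordinal \<Rightarrow> 'a" and S
  where "\<And>\<alpha>. \<alpha> < space_density X \<Longrightarrow> p \<alpha> \<in> topspace X - X closure_of (p ` {..<\<alpha>})"
    and "\<And>\<alpha>. \<alpha> < space_density X \<Longrightarrow> local_pi_base X (p \<alpha>) {S (\<alpha>, i) | i. i < \<kappa>}"
    and "\<And>\<alpha> i. \<alpha> < space_density X \<Longrightarrow> i < \<kappa> \<Longrightarrow>
      X closure_of (S (\<alpha>, i)) \<inter> X closure_of (p ` {..<\<alpha>}) = {}"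
    and "\<And>\<alpha> x. \<alpha> < space_density X \<Longrightarrow> h \<alpha> = Inl x \<Longrightarrow> d x \<in> topspace X \<Longrightarrow>
      d x \<in> X closure_of (p ` {..\<alpha>})"
    and "\<And>\<alpha> A. \<alpha> < space_density X \<Longrightarrow> h \<alpha> = Inr A \<Longrightarrow> A \<subseteq> {..<\<alpha>} \<times> {..<\<kappa>} \<Longrightarrow>
      topspace X \<inter> (\<Inter>a\<in>A. X closure_of S a) \<noteq> {} \<Longrightarrow>
      topspace X \<inter> (\<Inter>a\<in>A. X closure_of S a) \<inter> X closure_of (p ` {..\<alpha>}) \<noteq> {}"
proof -
  let ?lam = "space_density X"
  define C where "C f \<alpha> = X closure_of ((\<lambda>\<beta>. fst (f \<beta>)) ` {..<\<alpha>})"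
    for f :: "'a set ordinal \<Rightarrow> 'a \<times> ('a set ordinal \<Rightarrow> 'a set)" and \<alpha>
  \<comment> \<open>The set to be met at stage \<open>\<alpha>\<close>. It is empty, and so demands
    nothing, if the task mentions sets not yet chosen or a point outside the space.\<close>
  define K where "K f \<alpha> = topspace X \<inter> (case h \<alpha> of Inl x \<Rightarrow> {d x} |
      Inr A \<Rightarrow> if A \<subseteq> {..<\<alpha>} \<times> {..<\<kappa>} then \<Inter>a\<in>A. X closure_of (snd (f (fst a)) (snd a)) else {})"
    for f :: "'a set ordinal \<Rightarrow> 'a \<times> ('a set ordinal \<Rightarrow> 'a set)" and \<alpha>
  \<comment> \<open>A value is a point together with its \<pi>-base. Stages from \<open>?lam\<close>
    on carry no condition, because \<open>f\<close> must be total on the type.\<close>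
  define P where "P f \<alpha> v \<longleftrightarrow> (\<alpha> < ?lam \<longrightarrow>
      fst v \<in> topspace X - C f \<alpha> \<and> local_pi_base X (fst v) {snd v i | i. i < \<kappa>} \<and>
      (\<forall>i<\<kappa>. X closure_of (snd v i) \<inter> C f \<alpha> = {}) \<and>
      (K f \<alpha> \<noteq> {} \<and> K f \<alpha> \<inter> C f \<alpha> = {} \<longrightarrow> fst v \<in> K f \<alpha>))" for f \<alpha> v
  have "\<exists>f. \<forall>\<alpha>. P f \<alpha> (f \<alpha>)"
  proof (rule dependent_wf_choice[OF wf])
    \<comment> \<open>The condition at \<open>\<alpha>\<close> may depend only on earlier values;
      the guard on \<open>A\<close> in \<open>K\<close> secures this.\<close>
    fix f g :: "'a set ordinal \<Rightarrow> 'a \<times> ('a set ordinal \<Rightarrow> 'a set)" and \<alpha> v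
    assume "\<And>\<beta>. (\<beta>, \<alpha>) \<in> {(x, y). x < y} \<Longrightarrow> f \<beta> = g \<beta>"
    then have eq: "f \<beta> = g \<beta>" if "\<beta> < \<alpha>" for \<beta> using that by simp
    then have "C f \<alpha> = C g \<alpha>" unfolding C_def by simp
    moreover have "K f \<alpha> = K g \<alpha>"
    proof (cases "h \<alpha>")
      case (Inr A)
      have "(\<Inter>a\<in>A. X closure_of (snd (f (fst a)) (snd a))) = (\<Inter>a\<in>A. X closure_of (snd (g (fst a)) (snd a)))"
        if "A \<subseteq> {..<\<alpha>} \<times> {..<\<kappa>}"
        using that eq by (intro INF_cong refl) force
      then show ?thesis by (simp add: K_def Inr)
    qed (simp add: K_def)
    ultimately show "P f \<alpha> v = P g \<alpha> v" by (simp add: P_def)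
  next
    fix \<alpha> f
    assume "\<And>\<beta>. (\<beta>, \<alpha>) \<in> {(x, y). x < y} \<Longrightarrow> P f \<beta> (f \<beta>)"
    then have IH: "P f \<beta> (f \<beta>)" if "\<beta> < \<alpha>" for \<beta> using that by simp
    show "\<exists>v. P f \<alpha> v"
    proof (cases "\<alpha> < ?lam")
      case True
      let ?Q = "(\<lambda>\<beta>. fst (f \<beta>)) ` {..<\<alpha>}"
      have "?Q \<subseteq> topspace X"
      proof clarify
        fix \<beta> assume "\<beta> < \<alpha>"
        then show "fst (f \<beta>) \<in> topspace X" using IH[of \<beta>] True by (auto simp: P_def)
      qed
      moreover have "\<not> dense_in X ?Q"
        using space_density_le[OF _ image_lepoll] True leD by blast
      ultimately have "topspace X - C f \<alpha> \<noteq> {}"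
        unfolding dense_in_def C_def using closure_of_subset_topspace[of X ?Q] by blast
      moreover have "K f \<alpha> \<subseteq> topspace X" by (simp add: K_def)
      ultimately have "\<exists>q. q \<in> topspace X - C f \<alpha> \<and> (K f \<alpha> \<noteq> {} \<and> K f \<alpha> \<inter> C f \<alpha> = {} \<longrightarrow> q \<in> K f \<alpha>)"
        by (cases "K f \<alpha> \<noteq> {} \<and> K f \<alpha> \<inter> C f \<alpha> = {}") blast+
      then obtain q where q: "q \<in> topspace X - C f \<alpha>"
          "K f \<alpha> \<noteq> {} \<and> K f \<alpha> \<inter> C f \<alpha> = {} \<longrightarrow> q \<in> K f \<alpha>"
        by blast
      have "closedin X (C f \<alpha>)" by (simp add: C_def)
      then obtain s where "local_pi_base X q {s i | i. i < \<kappa>}"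
          "\<And>i. i < \<kappa> \<Longrightarrow> X closure_of (s i) \<inter> C f \<alpha> = {}"
        using local_pi_base_within[OF reg _ q(1) \<kappa>] by blast
      then have "P f \<alpha> (q, s)" using q by (simp add: P_def)
      then show ?thesis by blast
    qed (simp add: P_def)
  qed
  then obtain f where f: "\<And>\<alpha>. P f \<alpha> (f \<alpha>)" by blast
  define p where "p \<alpha> = fst (f \<alpha>)" for \<alpha>
  define S where "S a = snd (f (fst a)) (snd a)" for a
  have C: "C f \<alpha> = X closure_of (p ` {..<\<alpha>})" for \<alpha> by (simp add: C_def p_def)
  have p: "p \<alpha> \<in> topspace X - C f \<alpha>" "local_pi_base X (p \<alpha>) {S (\<alpha>, i) | i. i < \<kappa>}"
      "\<And>i. i < \<kappa> \<Longrightarrow> X closure_of (S (\<alpha>, i)) \<inter> C f \<alpha> = {}"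
      "K f \<alpha> \<noteq> {} \<Longrightarrow> K f \<alpha> \<inter> C f \<alpha> = {} \<Longrightarrow> p \<alpha> \<in> K f \<alpha>"
    if "\<alpha> < ?lam" for \<alpha>
    using f[of \<alpha>] that by (simp_all add: P_def p_def S_def)
  \<comment> \<open>The point \<open>p \<alpha>\<close> may itself be what meets the set, hence
    \<open>{..\<alpha>}\<close> and not \<open>{..<\<alpha>}\<close>.\<close>
  have hit: "K f \<alpha> \<inter> X closure_of (p ` {..\<alpha>}) \<noteq> {}" if \<alpha>: "\<alpha> < ?lam" "K f \<alpha> \<noteq> {}" for \<alpha>
  proof (cases "K f \<alpha> \<inter> C f \<alpha> = {}")
    case True
    have "p ` {..\<alpha>} \<subseteq> topspace X" using p(1) \<alpha>(1) by (auto dest: order_le_less_trans)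
    then have "p \<alpha> \<in> X closure_of (p ` {..\<alpha>})" using closure_of_subset by blast
    then show ?thesis using p(4)[OF \<alpha> True] by blast
  next
    case False
    have "C f \<alpha> \<subseteq> X closure_of (p ` {..\<alpha>})" unfolding C by (intro closure_of_mono image_mono) auto
    then show ?thesis using False by blast
  qed
  show ?thesis
  proof (rule that[of p S])
    fix \<alpha> assume \<alpha>: "\<alpha> < ?lam"
    show "p \<alpha> \<in> topspace X - X closure_of (p ` {..<\<alpha>})" using p(1)[OF \<alpha>] C by simp
    show "local_pi_base X (p \<alpha>) {S (\<alpha>, i) | i. i < \<kappa>}" by (rule p(2)[OF \<alpha>])
    show "X closure_of (S (\<alpha>, i)) \<inter> X closure_of (p ` {..<\<alpha>}) = {}" if "i < \<kappa>" for i
      using p(3)[OF \<alpha> that] C by simp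
    show "d x \<in> X closure_of (p ` {..\<alpha>})" if "h \<alpha> = Inl x" "d x \<in> topspace X" for x
      using hit[OF \<alpha>] that by (simp add: K_def)
    show "topspace X \<inter> (\<Inter>a\<in>A. X closure_of S a) \<inter> X closure_of (p ` {..\<alpha>}) \<noteq> {}"
      if "h \<alpha> = Inr A" "A \<subseteq> {..<\<alpha>} \<times> {..<\<kappa>}" "topspace X \<inter> (\<Inter>a\<in>A. X closure_of S a) \<noteq> {}" for A
    proof -
      have "K f \<alpha> = topspace X \<inter> (\<Inter>a\<in>A. X closure_of S a)"
        using that(1,2) by (simp add: K_def S_def)
      then show ?thesis using hit[OF \<alpha>] that(3) by simp
    qed
  qed
qed

section \<open>Assembling the Shapirovskii \<pi>-base\<close>

theorem theorem2p2:
  fixes X :: "'a topology"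
  assumes "regular_space X" and "t1_space X"
    and "ord_omega \<le> space_density X"
  shows "\<exists>S p. shapirovskii_pi_base X S p"
proof -
  define lam where "lam = space_density X"
  define \<kappa> where "\<kappa> = max ord_omega (pi_character X)"
  interpret sigma_kappa \<kappa>
    unfolding \<kappa>_def by unfold_locales (rule infinite_cardinal_max_pi_character)
  obtain D where D: "dense_in X D" "lam = ord_card D" unfolding lam_def using space_density_attained by blast
  have "infinite_cardinal lam"
    using assms(3) D(2) card_of_ord_ord_card[OF set_lepoll_set_plus_nat, of D]
    by (simp add: infinite_cardinal_iff lam_def[symmetric])
  then have "add_closed lam lam" by (rule infinite_cardinal_add_closed)
  \<comment> \<open>This makes \<open>lam\<close> itself an admissible \<open>\<delta>\<close> for
    the schedule, so every point of \<open>D\<close> is requested at a stage below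
    \<open>lam\<close>.\<close>
  then have lam_closed: "add_closed \<kappa> lam" if "\<kappa> \<le> lam"
    using that by (auto simp: add_closed_def intro: order_less_le_trans)
  obtain h where h_Inl: "\<And>x. x < lam \<Longrightarrow> \<exists>\<alpha><lam. h \<alpha> = Inl x"
    and h_Inr: "\<And>\<delta> A. 0 < \<delta> \<Longrightarrow> \<delta> \<le> lam \<Longrightarrow> add_closed \<kappa> \<delta> \<Longrightarrow> finite A \<Longrightarrow>
      A \<subseteq> {ord_gamma \<kappa> \<delta>..<\<delta>} \<times> {..<\<kappa>} \<Longrightarrow> \<exists>\<alpha><\<delta>. h \<alpha> = Inr A \<and> A \<subseteq> {..<\<alpha>} \<times> {..<\<kappa>}"
  proof (cases "\<kappa> \<le> lam")
    \<comment> \<open>If \<open>lam < \<kappa>\<close>, no \<open>\<delta>\<close> qualifies in condition (c) and only density has to be arranged.\<close>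
    case True
    show ?thesis
    proof (rule schedule_exists)
      fix h :: "'a set ordinal \<Rightarrow> 'a set ordinal + ('a set ordinal \<times> 'a set ordinal) set"
      assume "\<And>\<delta> x. add_closed \<kappa> \<delta> \<Longrightarrow> x < \<delta> \<Longrightarrow> \<exists>\<alpha><\<delta>. h \<alpha> = Inl x"
        and "\<And>\<delta> A. 0 < \<delta> \<Longrightarrow> add_closed \<kappa> \<delta> \<Longrightarrow> finite A \<Longrightarrow>
          A \<subseteq> {ord_gamma \<kappa> \<delta>..<\<delta>} \<times> {..<\<kappa>} \<Longrightarrow> \<exists>\<alpha><\<delta>. h \<alpha> = Inr A \<and> A \<subseteq> {..<\<alpha>} \<times> {..<\<kappa>}"
      then show ?thesis using that[of h] lam_closed[OF True] by simp
    qed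
  next
    case False
    then have "\<not> (0 < \<delta> \<and> \<delta> \<le> lam \<and> add_closed \<kappa> \<delta>)" for \<delta>
      using add_closed_imp_le order_trans by blast
    then show ?thesis using that[of Inl] by auto
  qed
  have "{..<lam} \<approx> D" unfolding D(2) by (rule ord_card_eqpoll[OF set_lepoll_set_plus_nat])
  then obtain d where d: "bij_betw d {..<lam} D" unfolding eqpoll_def by blast
  have "pi_character X \<le> \<kappa>" by (simp add: \<kappa>_def)
  obtain p S where
    p: "\<And>\<alpha>. \<alpha> < lam \<Longrightarrow> p \<alpha> \<in> topspace X - X closure_of (p ` {..<\<alpha>})"
    and S: "\<And>\<alpha>. \<alpha> < lam \<Longrightarrow> local_pi_base X (p \<alpha>) {S (\<alpha>, i) | i. i < \<kappa>}"
    and S_disjoint: "\<And>\<alpha> i. \<alpha> < lam \<Longrightarrow> i < \<kappa> \<Longrightarrow>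
      X closure_of (S (\<alpha>, i)) \<inter> X closure_of (p ` {..<\<alpha>}) = {}"
    and hit_Inl: "\<And>\<alpha> x. \<alpha> < lam \<Longrightarrow> h \<alpha> = Inl x \<Longrightarrow> d x \<in> topspace X \<Longrightarrow>
      d x \<in> X closure_of (p ` {..\<alpha>})"
    and hit_Inr: "\<And>\<alpha> A. \<alpha> < lam \<Longrightarrow> h \<alpha> = Inr A \<Longrightarrow> A \<subseteq> {..<\<alpha>} \<times> {..<\<kappa>} \<Longrightarrow>
      topspace X \<inter> (\<Inter>a\<in>A. X closure_of S a) \<noteq> {} \<Longrightarrow>
      topspace X \<inter> (\<Inter>a\<in>A. X closure_of S a) \<inter> X closure_of (p ` {..\<alpha>}) \<noteq> {}"
    apply (rule left_separated_sequence_exists[OF assms(1) \<open>pi_character X \<le> \<kappa>\<close> \<kappa>_pos,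
          where d = d and h = h, folded lam_def])
    subgoal premises prems for p S
      by (rule prems(1)[of p S]) (fact prems)+
    done
  have mono: "X closure_of (p ` {..<\<alpha>}) \<subseteq> X closure_of (p ` {..<\<beta>})" if "\<alpha> \<le> \<beta>" for \<alpha> \<beta>
    using that by (intro closure_of_mono image_mono) auto
  have dense: "dense_in X (p ` {..<lam})"
    unfolding dense_in_def
  proof
    show "p ` {..<lam} \<subseteq> topspace X" using p by auto
    have "y \<in> X closure_of (p ` {..<lam})" if y: "y \<in> D" for y
    proof -
      obtain x where x: "x < lam" "y = d x" using d y by (auto simp: bij_betw_def)
      then obtain \<alpha> where \<alpha>: "\<alpha> < lam" "h \<alpha> = Inl x" using h_Inl by blast
      have "d x \<in> X closure_of (p ` {..\<alpha>})"
        using hit_Inl[OF \<alpha>] D(1) y x by (auto simp: dense_in_def)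
      moreover have "p ` {..\<alpha>} \<subseteq> p ` {..<lam}" using \<alpha> by (auto intro: order_le_less_trans)
      ultimately show ?thesis using x closure_of_mono by blast
    qed
    then have "X closure_of D \<subseteq> X closure_of (p ` {..<lam})" by (intro closure_of_minimal) auto
    then show "X closure_of (p ` {..<lam}) = topspace X"
      using D(1) closure_of_subset_topspace[of X "p ` {..<lam}"] by (auto simp: dense_in_def)
  qed
  have left_sep: "left_separated X lam p"
    unfolding left_separated_def using p mono by fastforce
  have opens: "S ` ({..<lam} \<times> {..<\<kappa>}) \<subseteq> nonempty_opens X"
    using S unfolding local_pi_base_def by auto
  have disjoint: "X closure_of (p ` {..<\<alpha>}) \<inter>
      (\<Union>{X closure_of S (\<beta>, i) | \<beta> i. \<alpha> \<le> \<beta> \<and> \<beta> < lam \<and> i < \<kappa>}) = {}" for \<alpha>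
    using S_disjoint mono[of \<alpha>] by fastforce
  have meets: "topspace X \<inter> (\<Inter>a\<in>A. X closure_of S a) \<inter>
      (\<Union>\<alpha>\<in>{..<\<delta>}. X closure_of (p ` {..<\<alpha>})) \<noteq> {}"
    if \<delta>: "0 < \<delta>" "\<delta> \<le> lam" "\<exists>\<epsilon>. \<delta> = \<kappa> * \<epsilon>"
      and A: "finite A" "A \<subseteq> {ord_gamma \<kappa> \<delta>..<\<delta>} \<times> {..<\<kappa>}"
      "topspace X \<inter> (\<Inter>a\<in>A. X closure_of S a) \<noteq> {}" for \<delta> A
  proof -
    have closed: "add_closed \<kappa> \<delta>"
      using \<delta>(3) add_closed_mult[OF infinite_cardinal_add_closed[OF \<kappa>]] by blast
    obtain \<alpha> where \<alpha>: "\<alpha> < \<delta>" "h \<alpha> = Inr A" "A \<subseteq> {..<\<alpha>} \<times> {..<\<kappa>}"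
      using h_Inr[OF \<delta>(1,2) closed A(1,2)] by blast
    \<comment> \<open>The union in (c) uses only points before a stage less than
      \<open>\<delta>\<close>. The point chosen at \<open>\<alpha>\<close> counts from stage
      \<open>\<alpha> + 1\<close> on, so this stage must be below \<open>\<delta>\<close>
      too.\<close>
    have "\<alpha> + 1 < \<delta>" using closed \<alpha>(1) \<kappa>_gt_1 by (simp add: add_closed_def)
    have "{..\<alpha>} = {..<\<alpha> + 1}" by (auto simp: ordinal_less_add_1_iff)
    then have "X closure_of (p ` {..\<alpha>}) \<subseteq> (\<Union>\<alpha>\<in>{..<\<delta>}. X closure_of (p ` {..<\<alpha>}))"
      using \<open>\<alpha> + 1 < \<delta>\<close> UN_upper[of "\<alpha> + 1" "{..<\<delta>}" "\<lambda>\<beta>. X closure_of (p ` {..<\<beta>})"] by simp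
    moreover have "topspace X \<inter> (\<Inter>a\<in>A. X closure_of S a) \<inter> X closure_of (p ` {..\<alpha>}) \<noteq> {}"
      by (rule hit_Inr[OF order_less_le_trans[OF \<alpha>(1) \<delta>(2)] \<alpha>(2,3) A(3)])
    ultimately show ?thesis by blast
  qed
  have "shapirovskii_pi_base X S p"
    unfolding shapirovskii_pi_base_def Let_def lam_def[symmetric] \<kappa>_def[symmetric]
  proof (intro conjI)
    show "\<forall>\<alpha><lam. local_pi_base X (p \<alpha>) {S (\<alpha>, i) | i. i < \<kappa>}" using S by simp
    show "\<forall>\<alpha><lam. X closure_of (p ` {..<\<alpha>}) \<inter>
        (\<Union>{X closure_of S (\<beta>, i) | \<beta> i. \<alpha> \<le> \<beta> \<and> \<beta> < lam \<and> i < \<kappa>}) = {}"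
      using disjoint by simp
  qed (intro dense left_sep opens meets allI impI; elim conjE; assumption)+
  then show ?thesis by blast
qed

end
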